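(* For integers $n\ge 2$ and $d\ge 2$, let $m_{n,d}$ denote the minimum number of nodal domains among all time-dependent homogeneous caloric polynomials of degree $d$ in $\mathbb{R}^{n+1}=\mathbb{R}^n\times\mathbb{R}$. Then for all $d\ge 2$, $$m_{2,d}=\begin{cases}2, & \text{when } d\not\equiv 0 \pmod 4,\\ 3, & \text{when } d\equiv 0\pmod 4,\end{cases}$$ and, for all $n\ge 3$ and all $d\ge 2$, $m_{n,d}=2$.
   Context: Write points of $\mathbb{R}^{n+1}=\mathbb{R}^n\times\mathbb{R}$ as $(x,t)$ with $x\in\mathbb{R}^n$ (space), $t\in\mathbb{R}$ (time), and let $\Delta=\sum_{i=1}^n\partial_{x_i}^2$ (space variables only). A homogeneous caloric polynomial (hcp) of degree $d\in\{0,1,2,\dots\}$ in $\mathbb{R}^{n+1}$ is a real, not identically zero polynomial $p(x,t)$ satisfying the heat equation $(\partial_t-\Delta)p=0$ and the parabolic homogeneity $p(\lambda x,\lambda^2 t)=\lambda^d p(x,t)$ for all $\lambda>0$ and all $(x,t)$. An hcp $p$ is time-dependent if $\partial_t p\not\equiv 0$. The nodal domains of a continuous function $u$ on $\mathbb{R}^{n+1}$ are the connected components of $\{(x,t):u(x,t)\neq 0\}$. *)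

theory Defs
  imports "HOL-Analysis.Analysis"
begin

definition partial_along :: "'a::real_normed_vector \<Rightarrow> ('a \<Rightarrow> real) \<Rightarrow> 'a \<Rightarrow> real" where
  "partial_along v f z = deriv (\<lambda>s. f (z + s *\<^sub>R v)) 0"

definition time_deriv :: "((real ^ 'n) \<times> real \<Rightarrow> real) \<Rightarrow> (real ^ 'n) \<times> real \<Rightarrow> real" where
  "time_deriv p = partial_along (0, 1) p"

definition space_laplacian ::
    "((real ^ 'n) \<times> real \<Rightarrow> real) \<Rightarrow> (real ^ 'n) \<times> real \<Rightarrow> real" where
  "space_laplacian p z =
     (\<Sum>i\<in>UNIV. partial_along (axis i 1, 0) (partial_along (axis i 1, 0) p) z)"

definition hcp :: "nat \<Rightarrow> ((real ^ 'n) \<times> real \<Rightarrow> real) \<Rightarrow> bool" where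
  "hcp d p \<longleftrightarrow>
     real_polynomial_function p \<and>
     (\<exists>z. p z \<noteq> 0) \<and>
     (\<forall>z. time_deriv p z - space_laplacian p z = 0) \<and>
     (\<forall>l>0. \<forall>x t. p (l *\<^sub>R x, l\<^sup>2 * t) = l ^ d * p (x, t))"

definition time_dependent :: "((real ^ 'n) \<times> real \<Rightarrow> real) \<Rightarrow> bool" where
  "time_dependent p \<longleftrightarrow> (\<exists>z. time_deriv p z \<noteq> 0)"

definition nodal_domains :: "((real ^ 'n) \<times> real \<Rightarrow> real) \<Rightarrow> ((real ^ 'n) \<times> real) set set" where
  "nodal_domains u = components {z. u z \<noteq> 0}"

text \<open>Counted in \<^typ>\<open>enat\<close>, since \<^const>\<open>card\<close> is 0 on infinite sets.\<close>

definition num_nodal_domains :: "((real ^ 'n) \<times> real \<Rightarrow> real) \<Rightarrow> enat" where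
  "num_nodal_domains u =
     (if finite (nodal_domains u) then enat (card (nodal_domains u)) else \<infinity>)"

text \<open>The dimension \<open>n\<close> is \<open>CARD('n)\<close>. As \<^typ>\<open>enat\<close> is well-ordered, the infimum of a nonempty
  set is its minimum; the infimum of the empty set is \<open>\<infinity>\<close>. A finite value therefore includes
  the existence of a time-dependent polynomial of degree \<open>d\<close> attaining it.\<close>

definition min_nodal_domains :: "'n::finite itself \<Rightarrow> nat \<Rightarrow> enat" where
  "min_nodal_domains _ d =
     (INF p \<in> {p :: (real ^ 'n) \<times> real \<Rightarrow> real. hcp d p \<and> time_dependent p}. num_nodal_domains p)"

end

theory Submission
  imports Defs
begin

text \<open>
  Lower bounds. A homogeneous caloric polynomial of positive degree vanishes at the origin, so by the
  strong maximum principle it takes both signs. Now let \<open>n = 2\<close> and \<open>4 dvd d\<close>. Then \<open>p\<close> is even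
  in \<open>x\<close> and has the same sign, say \<open>\<ge> 0\<close>, on both halves of the time axis. If \<open>{p < 0}\<close> is connected,
  it contains a compact connected set that is symmetric under \<open>x \<mapsto> -x\<close> and therefore separates the two halves of
  the time axis up to parabolic dilations. If \<open>{p > 0}\<close> were connected too, it would stay away from one of these
  halves, where \<open>p\<close> would have a local maximum with value \<open>0\<close>, contradicting the strong maximum principle.

  Examples. Let \<open>H d x t\<close> be the one-dimensional heat polynomials and \<open>\<epsilon> > 0\<close> small.
  For odd \<open>d\<close>, \<open>H d x t + \<epsilon> H d y t\<close> has two nodal domains: the strips of \<open>H d x t\<close> are joined, positive
  ones at \<open>y = \<infinity>\<close>, negative ones at \<open>y = -\<infinity>\<close>. For even \<open>d\<close>, \<open>H d x t + \<epsilon> x H (d - 1) y t\<close>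
  behaves like this on each half space \<open>x > 0\<close>, \<open>x < 0\<close>, and on \<open>x = 0\<close> it equals \<open>H d 0 t\<close>, which is positive
  for \<open>t > 0\<close> and, for \<open>t < 0\<close>, negative precisely if \<open>4\<close> does not divide \<open>d\<close>. In dimension three,
  \<open>x H (d - 1) y t + H d z t\<close> with even \<open>d\<close> has two nodal domains: \<open>x\<close> can be moved until the
  first term dominates, and then \<open>z\<close> until the second term has the desired sign.
\<close>

section \<open>Partial derivatives and the strong maximum principle\<close>

text \<open>\<open>deriv\<close> carries no information without differentiability. Structural
  induction supplies a derivative that is again polynomial, so that directional derivatives can be
  iterated.\<close>

lemma polynomial_has_partial:
  fixes f :: "'a::real_normed_vector \<Rightarrow> real"
  assumes "real_polynomial_function f"
  shows "\<exists>f'. real_polynomial_function f' \<and>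
    (\<forall>z s. ((\<lambda>s. f (z + s *\<^sub>R v)) has_real_derivative f' (z + s *\<^sub>R v)) (at s))"
  using assms
proof (induction rule: real_polynomial_function.induct)
  case (linear f)
  interpret bounded_linear f by fact
  show ?case
  proof (intro exI[of _ "\<lambda>_. f v"] conjI allI)
    show "((\<lambda>s. f (z + s *\<^sub>R v)) has_real_derivative f v) (at s)" for z s
      unfolding add scaleR by (auto intro!: derivative_eq_intros)
  qed (rule real_polynomial_function.intros(2))
next
  case (const c)
  show ?case
    by (intro exI[of _ "\<lambda>_. 0"]) (auto intro: real_polynomial_function.intros(2))
next
  case (add f g)
  then obtain f' g' where
    "real_polynomial_function f'" "real_polynomial_function g'"
    "\<And>z s. ((\<lambda>s. f (z + s *\<^sub>R v)) has_real_derivative f' (z + s *\<^sub>R v)) (at s)"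
    "\<And>z s. ((\<lambda>s. g (z + s *\<^sub>R v)) has_real_derivative g' (z + s *\<^sub>R v)) (at s)"
    by blast
  then show ?case
    by (intro exI[of _ "\<lambda>z. f' z + g' z"] conjI allI DERIV_add real_polynomial_function.intros(3)) auto
next
  case (mult f g)
  then obtain f' g' where
    "real_polynomial_function f'" "real_polynomial_function g'"
    "\<And>z s. ((\<lambda>s. f (z + s *\<^sub>R v)) has_real_derivative f' (z + s *\<^sub>R v)) (at s)"
    "\<And>z s. ((\<lambda>s. g (z + s *\<^sub>R v)) has_real_derivative g' (z + s *\<^sub>R v)) (at s)"
    by blast
  with mult.hyps show ?case
    by (intro exI[of _ "\<lambda>z. f' z * g z + g' z * f z"] conjI allI DERIV_mult
        real_polynomial_function.intros(3) real_polynomial_function.intros(4)) auto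
qed

lemma partial_along_eqI:
  "((\<lambda>s. f (z + s *\<^sub>R v)) has_real_derivative c) (at 0) \<Longrightarrow> partial_along v f z = c"
  unfolding partial_along_def by (rule DERIV_imp_deriv)

lemma polynomial_partial_along:
  fixes f :: "'a::real_normed_vector \<Rightarrow> real"
  assumes "real_polynomial_function f"
  shows "real_polynomial_function (partial_along v f)"
    and "((\<lambda>s. f (z + s *\<^sub>R v)) has_real_derivative partial_along v f (z + s *\<^sub>R v)) (at s)"
proof -
  obtain f' where f': "real_polynomial_function f'"
    "\<And>z s. ((\<lambda>s. f (z + s *\<^sub>R v)) has_real_derivative f' (z + s *\<^sub>R v)) (at s)"
    using polynomial_has_partial[OF assms] by blast
  have "partial_along v f z = f' z" for z
    using f'(2)[of z 0] by (intro partial_along_eqI) simp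
  then have "partial_along v f = f'" ..
  then show "real_polynomial_function (partial_along v f)"
    and "((\<lambda>s. f (z + s *\<^sub>R v)) has_real_derivative partial_along v f (z + s *\<^sub>R v)) (at s)"
    using f' by auto
qed

lemma real_polynomial_function_continuous:
  "real_polynomial_function f \<Longrightarrow> continuous_on S f"
  by (simp add: continuous_at_imp_continuous_on continuous_real_polymonial_function)

lemma real_polynomial_zero_on_infinite:
  fixes f :: "real \<Rightarrow> real"
  assumes "real_polynomial_function f" "infinite S" "\<And>s. s \<in> S \<Longrightarrow> f s = 0"
  shows "f s = 0"
proof -
  obtain a n where f: "f = (\<lambda>x. \<Sum>i\<le>n. a i * x ^ i)"
    using assms(1) by (auto simp: real_polynomial_function_iff_sum)
  have "infinite {x. (\<Sum>i\<le>n. a i * x ^ i) = 0}"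
    by (rule infinite_super[OF _ assms(2)]) (use assms(3) in \<open>simp add: f subset_iff\<close>)
  then have "\<forall>i\<le>n. a i = 0"
    using polyfun_rootbound by blast
  then show ?thesis
    by (simp add: f)
qed

text \<open>On the line through \<open>a\<close> and \<open>z\<close> the function is a univariate
  polynomial vanishing on a nonempty open, hence infinite, set of parameters; at parameter 1 its
  value is \<open>f z\<close>.\<close>

lemma polynomial_zero_on_open:
  fixes f :: "'a::euclidean_space \<Rightarrow> real"
  assumes f: "real_polynomial_function f" and U: "open U" "a \<in> U" "\<And>z. z \<in> U \<Longrightarrow> f z = 0"
  shows "f z = 0"
proof -
  define g where "g s = f (a + s *\<^sub>R (z - a))" for s
  have g: "real_polynomial_function g"
  proof -
    have "polynomial_function (\<lambda>s::real. a + s *\<^sub>R (z - a))"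
      by (intro polynomial_function_add polynomial_function_const polynomial_function_mult)
        (auto simp: polynomial_function_id)
    from real_polynomial_function_compose[OF this f] show ?thesis
      by (simp add: g_def[abs_def] o_def)
  qed
  have "open ((\<lambda>s. a + s *\<^sub>R (z - a)) -` U)"
    by (intro open_vimage U continuous_intros)
  moreover have "0 \<in> (\<lambda>s. a + s *\<^sub>R (z - a)) -` U"
    using U by simp
  ultimately have "infinite ((\<lambda>s. a + s *\<^sub>R (z - a)) -` U)"
    using finite_imp_not_open by blast
  then have "g 1 = 0"
    by (rule real_polynomial_zero_on_infinite[OF g]) (use U(3) in \<open>auto simp: g_def\<close>)
  then show ?thesis
    by (simp add: g_def)
qed

section \<open>Barrier argument for the strong maximum principle\<close>

text \<open>At the minimum \<open>g' 0 = 0\<close>. If \<open>c < 0\<close>, then \<open>g'\<close>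
  is negative just to the right of 0, and the mean value theorem makes \<open>g\<close> drop below
  \<open>g 0\<close>.\<close>

lemma local_min_second_derivative_nonneg:
  fixes g g' :: "real \<Rightarrow> real"
  assumes g: "\<And>s. (g has_real_derivative g' s) (at s)"
    and g': "(g' has_real_derivative c) (at 0)"
    and e: "0 < e" "\<And>s. \<bar>s\<bar> < e \<Longrightarrow> g 0 \<le> g s"
  shows "0 \<le> c"
proof (rule ccontr)
  assume "\<not> 0 \<le> c"
  then have "c < 0" by simp
  have g'0: "g' 0 = 0"
    using DERIV_local_min[OF g[of 0] e(1)] e(2) by simp
  obtain d where d: "d > 0" "\<And>h. h > 0 \<Longrightarrow> h < d \<Longrightarrow> g' (0 + h) < g' 0"
    using DERIV_neg_dec_right[OF g' \<open>c < 0\<close>] by blast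
  define s where "s = min d e / 2"
  have s: "0 < s" "s < d" "s < e"
    using d e by (auto simp: s_def min_def)
  obtain z where z: "0 < z" "z < s" "g s - g 0 = (s - 0) * g' z"
    using MVT2[OF s(1), of g g'] g by blast
  have "g' z < 0"
    using d(2)[of z] z s g'0 by simp
  then have "g s < g 0"
    using z s by (simp add: mult_pos_neg algebra_simps)
  then show False
    using e(2)[of s] s by simp
qed

text \<open>Complete the square in \<open>b = (C + 8) * q / r\<close>. The leading coefficient is
  the decay rate \<open>\<mu>\<close> of the barrier below, and the inequality is what excludes a
  negative minimum there.\<close>

lemma barrier_quadratic_pos:
  fixes q r C :: real
  assumes "r > 0"
  shows "0 < (C + 8)\<^sup>2 / r\<^sup>2 * q\<^sup>2 - (C + 8) * q + 8 * r\<^sup>2"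
proof -
  define b where "b = (C + 8) * q / r"
  have "(C + 8)\<^sup>2 / r\<^sup>2 * q\<^sup>2 - (C + 8) * q + 8 * r\<^sup>2 = (b - r / 2)\<^sup>2 + 31 / 4 * r\<^sup>2"
    using assms by (simp add: b_def power2_eq_square field_simps)
  also have "\<dots> > 0"
    using assms by (intro add_nonneg_pos) auto
  finally show ?thesis .
qed

lemma norm_add_scaleR_axis:
  fixes y :: "real ^ 'n"
  shows "(norm (y + s *\<^sub>R axis k 1))\<^sup>2 = (norm y)\<^sup>2 + 2 * s * y $ k + s\<^sup>2"
  unfolding power2_norm_eq_inner
  by (simp add: inner_add_left inner_add_right inner_axis inner_axis' power2_eq_square algebra_simps)

text \<open>The comparison function \<open>exp (-\<mu> (t - t1)) (r\<^sup>2 - \<bar>x - \<xi> t\<bar>\<^sup>2)\<^sup>2\<close> lives on the slanted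
  cylinder of radius \<open>r\<close> around the segment from \<open>(x1, t1)\<close> to \<open>(x0, t0)\<close>; it vanishes on the lateral
  boundary and is a strict subsolution of the heat equation once \<open>\<mu>\<close> is large.\<close>

lemma caloric_pos_propagates:
  fixes v :: "(real ^ 'n::finite) \<times> real \<Rightarrow> real" and x0 x1 :: "real ^ 'n"
  assumes poly: "real_polynomial_function v"
    and caloric: "\<And>z. time_deriv v z = space_laplacian v z"
    and r: "r > 0" and t: "t1 < t0"
    and nonneg: "\<And>x t. t1 \<le> t \<Longrightarrow> t \<le> t0 \<Longrightarrow>
      dist x (x1 + ((t - t1) / (t0 - t1)) *\<^sub>R (x0 - x1)) \<le> r \<Longrightarrow> 0 \<le> v (x, t)"
    and k: "\<kappa> > 0" "\<And>x. dist x x1 \<le> r \<Longrightarrow> \<kappa> \<le> v (x, t1)"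
  shows "0 < v (x0, t0)"
proof -
  define V where "V = (1 / (t0 - t1)) *\<^sub>R (x0 - x1)"
  define \<xi> where "\<xi> t = x1 + (t - t1) *\<^sub>R V" for t
  define n where "n = real CARD('n)"
  \<comment> \<open>\<open>C\<close> absorbs the drift term \<open>4 * (y \<bullet> V)\<close> and
    the dimension term \<open>4 * n\<close>; \<open>\<mu>\<close> is the coefficient from
    \<open>barrier_quadratic_pos\<close>; \<open>\<eta>\<close> keeps the barrier at most
    \<open>\<kappa>\<close> at time \<open>t1\<close>.\<close>
  define C where "C = 4 * r * norm V + 4 * n"
  define \<mu> where "\<mu> = (C + 8)\<^sup>2 / r\<^sup>2"
  define \<eta> where "\<eta> = \<kappa> / r ^ 4"
  have \<eta>: "\<eta> > 0"
    using k r by (simp add: \<eta>_def)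
  have \<xi>: "\<xi> t1 = x1" "\<xi> t0 = x0"
    using t by (auto simp: \<xi>_def V_def)
  define q where "q x t = r\<^sup>2 - (norm (x - \<xi> t))\<^sup>2" for x t
  define w where "w z = v z - \<eta> * exp (- \<mu> * (snd z - t1)) * (q (fst z) (snd z))\<^sup>2" for z
  define K where "K = (\<lambda>(y, t). (y + \<xi> t, t)) ` (cball 0 r \<times> {t1..t0})"
  have mem_K: "(x, t) \<in> K \<longleftrightarrow> norm (x - \<xi> t) \<le> r \<and> t1 \<le> t \<and> t \<le> t0" for x t
  proof
    assume "norm (x - \<xi> t) \<le> r \<and> t1 \<le> t \<and> t \<le> t0"
    then show "(x, t) \<in> K"
      unfolding K_def by (intro image_eqI[of _ _ "(x - \<xi> t, t)"]) auto
  qed (auto simp: K_def)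
  have cont_\<xi>: "continuous_on S (\<lambda>z. \<xi> (snd z))" for S :: "((real^'n) \<times> real) set"
    unfolding \<xi>_def by (intro continuous_intros)
  have "compact K"
    unfolding K_def case_prod_unfold
    by (intro compact_continuous_image compact_Times continuous_intros cont_\<xi>) auto
  moreover have "K \<noteq> {}"
    using mem_K[of x0 t0] \<xi> t r by auto
  moreover have "continuous_on K w"
    unfolding w_def q_def
    by (intro continuous_intros cont_\<xi> real_polynomial_function_continuous poly)
  ultimately obtain z where z: "z \<in> K" "\<And>z'. z' \<in> K \<Longrightarrow> w z \<le> w z'"
    by (metis continuous_attains_inf)
  obtain x s where zxs: "z = (x, s)"
    by fastforce
  have xs: "norm (x - \<xi> s) \<le> r" "t1 \<le> s" "s \<le> t0"
    using z(1) mem_K zxs by auto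
  have v_nonneg: "0 \<le> v (x, t)" if "(x, t) \<in> K" for x t
    using nonneg[of t x] that by (simp add: mem_K \<xi>_def V_def dist_norm)
  \<comment> \<open>A negative minimum lies neither on the lateral boundary, where the barrier
    vanishes, nor at time \<open>t1\<close>. Elsewhere the first and second order conditions at the
    minimum contradict the heat equation.\<close>
  have "0 \<le> w z"
  proof (rule ccontr)
    assume "\<not> 0 \<le> w z"
    then have neg: "w (x, s) < 0"
      using zxs by simp
    define E where "E = \<eta> * exp (- \<mu> * (s - t1))"
    define y where "y = x - \<xi> s"
    define Q where "Q = r\<^sup>2 - (norm y)\<^sup>2"
    have E: "E > 0"
      using \<eta> by (simp add: E_def)
    have w_xs: "w (x, s) = v (x, s) - E * Q\<^sup>2"
      by (simp add: w_def E_def Q_def q_def y_def)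
    have "norm y \<noteq> r"
      using neg v_nonneg[of x s] z(1) zxs by (auto simp: w_xs Q_def)
    then have y: "norm y < r"
      using xs by (simp add: y_def)
    then have Q: "Q > 0"
      by (simp add: Q_def power_strict_mono)
    have "s \<noteq> t1"
    proof
      assume "s = t1"
      then have "\<kappa> \<le> v (x, s)" "E = \<eta>"
        using k(2)[of x] xs \<xi> by (auto simp: dist_norm E_def)
      moreover have "Q\<^sup>2 \<le> (r\<^sup>2)\<^sup>2"
        using Q by (intro power_mono) (auto simp: Q_def)
      then have "\<eta> * Q\<^sup>2 \<le> \<eta> * r ^ 4"
        using \<eta> by simp
      moreover have "\<eta> * r ^ 4 = \<kappa>"
        using r by (simp add: \<eta>_def)
      ultimately show False
        using neg w_xs by simp
    qed
    then have s: "t1 < s"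
      using xs by simp
    have "0 \<le> partial_along (axis k 1, 0) (partial_along (axis k 1, 0) v) (x, s)
        + E * (4 * Q - 8 * (y $ k)\<^sup>2)" for k
    proof (rule local_min_second_derivative_nonneg)
      let ?e = "(axis k 1, 0) :: (real^'n) \<times> real"
      let ?g = "\<lambda>h. v ((x, s) + h *\<^sub>R ?e) - E * (Q - 2 * h * y $ k - h\<^sup>2)\<^sup>2"
      have g: "?g h = w (x + h *\<^sub>R axis k 1, s)" for h
      proof -
        have "norm (x + h *\<^sub>R axis k 1 - \<xi> s) ^ 2 = (norm y)\<^sup>2 + 2 * h * y $ k + h\<^sup>2"
          using norm_add_scaleR_axis[of y h k] by (simp add: y_def algebra_simps)
        then show ?thesis
          by (simp add: w_def E_def q_def Q_def algebra_simps)
      qed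
      show "(?g has_real_derivative
          partial_along ?e v ((x, s) + h *\<^sub>R ?e) + E * (4 * (Q - 2 * h * y $ k - h\<^sup>2) * (y $ k + h))) (at h)" for h
        by (rule derivative_eq_intros polynomial_partial_along(2) poly refl)+
           (simp add: algebra_simps power2_eq_square)
      show "((\<lambda>h. partial_along ?e v ((x, s) + h *\<^sub>R ?e) + E * (4 * (Q - 2 * h * y $ k - h\<^sup>2) * (y $ k + h)))
          has_real_derivative partial_along ?e (partial_along ?e v) (x, s)
          + E * (4 * Q - 8 * (y $ k)\<^sup>2)) (at 0)"
        by (rule derivative_eq_intros polynomial_partial_along poly refl)+
           (simp add: algebra_simps power2_eq_square)
      show "0 < r - norm y"
        using y by simp
      show "?g 0 \<le> ?g h" if "\<bar>h\<bar> < r - norm y" for h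
      proof -
        have "norm (x + h *\<^sub>R axis k 1 - \<xi> s) = norm (y + h *\<^sub>R axis k 1)"
          by (simp add: y_def algebra_simps)
        also have "\<dots> \<le> norm y + \<bar>h\<bar>"
          using norm_triangle_ineq[of y "h *\<^sub>R axis k 1"] by (simp add: norm_axis_1)
        finally have "(x + h *\<^sub>R axis k 1, s) \<in> K"
          using that xs by (simp add: mem_K)
        then show ?thesis
          using z(2) unfolding g zxs by simp
      qed
    qed
    then have "0 \<le> (\<Sum>k\<in>UNIV. partial_along (axis k 1, 0) (partial_along (axis k 1, 0) v) (x, s)
        + E * (4 * Q - 8 * (y $ k)\<^sup>2))"
      by (intro sum_nonneg) auto
    also have "\<dots> = space_laplacian v (x, s) + E * (4 * n * Q - 8 * (norm y)\<^sup>2)"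
      by (simp add: space_laplacian_def sum.distrib sum_subtractf n_def power2_norm_eq_inner inner_vec_def
          flip: sum_distrib_left) (simp add: power2_eq_square algebra_simps)
    finally have space: "0 \<le> space_laplacian v (x, s) + E * (4 * n * Q - 8 * (norm y)\<^sup>2)" .
    let ?T = "(0, 1) :: (real^'n) \<times> real"
    let ?g = "\<lambda>h. v ((x, s) + h *\<^sub>R ?T)
      - \<eta> * exp (- \<mu> * (s + h - t1)) * (Q + 2 * h * (y \<bullet> V) - h\<^sup>2 * (V \<bullet> V))\<^sup>2"
    have g: "?g h = w (x, s + h)" for h
    proof -
      have "x - \<xi> (s + h) = y - h *\<^sub>R V"
        by (simp add: y_def \<xi>_def algebra_simps)
      then have "(norm (x - \<xi> (s + h)))\<^sup>2 = (norm y)\<^sup>2 - 2 * h * (y \<bullet> V) + h\<^sup>2 * (V \<bullet> V)"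
        unfolding power2_norm_eq_inner
        by (simp add: inner_diff_left inner_diff_right inner_commute power2_eq_square)
      then have "q x (s + h) = Q + 2 * h * (y \<bullet> V) - h\<^sup>2 * (V \<bullet> V)"
        by (simp add: q_def Q_def)
      then show ?thesis
        by (simp add: w_def)
    qed
    have der: "(?g has_real_derivative time_deriv v (x, s) - E * (- \<mu> * Q\<^sup>2 + 4 * Q * (y \<bullet> V))) (at 0)"
      unfolding time_deriv_def
      by (rule derivative_eq_intros polynomial_partial_along(2) poly refl)+
         (simp add: algebra_simps power2_eq_square E_def)
    \<comment> \<open>The minimum may lie at the final time \<open>t0\<close>, so only earlier times
      can be compared; this gives a nonpositive time derivative of \<open>w\<close> instead of a
      vanishing one.\<close>
    have time: "time_deriv v (x, s) - E * (- \<mu> * Q\<^sup>2 + 4 * Q * (y \<bullet> V)) \<le> 0"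
    proof (rule ccontr)
      assume "\<not> ?thesis"
      then obtain d where d: "d > 0" "\<And>h. h > 0 \<Longrightarrow> h < d \<Longrightarrow> ?g (0 - h) < ?g 0"
        using DERIV_pos_inc_left[OF der] by auto
      have "continuous (at 0) (\<lambda>h. norm (x - \<xi> (s - h)))"
        unfolding \<xi>_def by (intro continuous_intros)
      then have "\<forall>\<^sub>F h in at 0. norm (x - \<xi> (s - h)) < r"
        using y by (intro order_tendstoD(2)[of _ "norm (x - \<xi> (s - 0))"]) (auto simp: continuous_at y_def)
      then obtain d' where d': "d' > 0" "\<And>h. h \<noteq> 0 \<Longrightarrow> \<bar>h\<bar> < d' \<Longrightarrow> norm (x - \<xi> (s - h)) < r"
        unfolding eventually_at by (auto simp: dist_real_def)
      define h where "h = min (min d d') (s - t1) / 2"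
      have h: "0 < h" "h < d" "h < d'" "h < s - t1"
        using d(1) d'(1) s by (auto simp: h_def min_def)
      then have "(x, s + - h) \<in> K"
        using d'(2)[of h] xs by (simp add: mem_K)
      then have "w (x, s + 0) \<le> w (x, s + - h)"
        using z(2) zxs by simp
      then show False
        using d(2)[of h] h unfolding g by simp
    qed
    have "y \<bullet> V \<le> r * norm V"
      using norm_cauchy_schwarz[of y V] y mult_right_mono[of "norm y" r "norm V"] by simp
    then have "4 * Q * (y \<bullet> V) + 4 * n * Q \<le> C * Q"
      using Q by (simp add: C_def algebra_simps)
    \<comment> \<open>Combining the space and time conditions cancels \<open>v\<close> by the heat
      equation and leaves an inequality for the barrier alone.\<close>
    moreover have "0 \<le> E * (- \<mu> * Q\<^sup>2 + 4 * Q * (y \<bullet> V) + 4 * n * Q - 8 * (norm y)\<^sup>2)"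
      using space time caloric[of "(x, s)"] by (simp add: algebra_simps)
    then have "0 \<le> - \<mu> * Q\<^sup>2 + 4 * Q * (y \<bullet> V) + 4 * n * Q - 8 * (norm y)\<^sup>2"
      using E by (simp add: zero_le_mult_iff)
    ultimately have "0 \<le> - \<mu> * Q\<^sup>2 + C * Q - 8 * (norm y)\<^sup>2"
      by linarith
    also have "\<dots> = - (\<mu> * Q\<^sup>2 - (C + 8) * Q + 8 * r\<^sup>2)"
      by (simp add: Q_def algebra_simps)
    also have "\<dots> < 0"
      using barrier_quadratic_pos[OF r, of C Q] by (simp add: \<mu>_def)
    finally show False
      by simp
  qed
  then have "0 \<le> w (x0, t0)"
    using z(2)[of "(x0, t0)"] mem_K[of x0 t0] \<xi> t r by auto
  moreover have "w (x0, t0) < v (x0, t0)"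
    using \<eta> r by (simp add: w_def q_def \<xi>)
  ultimately show ?thesis
    by linarith
qed


lemma caloric_uminus:
  assumes poly: "real_polynomial_function p" and caloric: "time_deriv p z = space_laplacian p z"
  shows "time_deriv (\<lambda>z. - p z) z = space_laplacian (\<lambda>z. - p z) z"
proof -
  have partial_v: "partial_along u (\<lambda>z. - p z) = (\<lambda>z. - partial_along u p z)" for u
    by (rule ext, rule partial_along_eqI)
       (use polynomial_partial_along(2)[OF poly, where v = u and s = 0] in \<open>auto intro!: derivative_eq_intros\<close>)
  have partial_v2: "partial_along u (\<lambda>z. - partial_along u p z) z = - partial_along u (partial_along u p) z" for u z
    by (rule partial_along_eqI)
       (use polynomial_partial_along(2)[OF polynomial_partial_along(1)[OF poly, of u], where z = z and v = u and s = 0] in \<open>auto intro!: derivative_eq_intros\<close>)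
  show ?thesis
    using caloric by (simp add: time_deriv_def space_laplacian_def partial_v partial_v2 sum_negf)
qed

text \<open>If \<open>p\<close> is not identically zero, it is nonzero, hence negative, at some
  point slightly earlier than \<open>z0\<close> and close to it. Positivity of \<open>-p\<close> on
  a small ball there propagates forward along a slanted cylinder inside \<open>U\<close> up to
  \<open>z0\<close>, contradicting \<open>p z0 = 0\<close>.\<close>

theorem caloric_strong_maximum:
  fixes p :: "(real ^ 'n::finite) \<times> real \<Rightarrow> real"
  assumes poly: "real_polynomial_function p"
    and caloric: "\<And>z. time_deriv p z = space_laplacian p z"
    and U: "open U" "z0 \<in> U" "\<And>z. z \<in> U \<Longrightarrow> p z \<le> 0"
    and z0: "p z0 = 0"
  shows "p z = 0"
proof (rule ccontr)
  assume nz: "p z \<noteq> 0"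
  obtain x0 t0 where xt: "z0 = (x0, t0)"
    by fastforce
  obtain A B where AB: "open A" "open B" "x0 \<in> A" "t0 \<in> B" "A \<times> B \<subseteq> U"
    by (rule open_prod_elim[OF U(1,2)]) (auto simp: xt)
  obtain R1 R2 where R12: "R1 > 0" "cball x0 R1 \<subseteq> A" "R2 > 0" "cball t0 R2 \<subseteq> B"
    using AB(1-4) unfolding open_contains_cball by meson
  let ?O = "ball x0 (R1 / 2) \<times> {t0 - R2<..<t0}"
  have "open ?O" "(x0, t0 - R2 / 2) \<in> ?O"
    using R12 by (auto intro: open_Times)
  then obtain x1 t1 where 1: "(x1, t1) \<in> ?O" "p (x1, t1) \<noteq> 0"
    using polynomial_zero_on_open[OF poly, of ?O "(x0, t0 - R2 / 2)" z] nz by fastforce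
  then have x1: "dist x0 x1 < R1 / 2" and t1: "t0 - R2 < t1" "t1 < t0"
    by auto
  have inU: "(x, t) \<in> U" if "dist x0 x \<le> R1" "dist t0 t \<le> R2" for x t
    using that R12 AB by (auto simp: subset_iff)
  have "p (x1, t1) < 0"
    using 1 U(3)[OF inU[of x1 t1]] x1 t1 R12 by (auto simp: dist_real_def)
  moreover have "continuous_on UNIV (\<lambda>x. p (x, t1))"
    using real_polynomial_function_continuous[OF poly, of UNIV]
    by (intro continuous_on_compose2[where g = p and f = "\<lambda>x. (x, t1)"] continuous_intros) auto
  then have "isCont (\<lambda>x. p (x, t1)) x1"
    by (simp add: continuous_on_eq_continuous_at)
  then have "((\<lambda>x. p (x, t1)) \<longlongrightarrow> p (x1, t1)) (nhds x1)"
    by (simp add: isCont_def tendsto_nhds_iff)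
  ultimately have "\<forall>\<^sub>F x in nhds x1. p (x, t1) < p (x1, t1) / 2"
    by (intro order_tendstoD(2)) auto
  then obtain e where e: "e > 0" "\<And>x. dist x x1 < e \<Longrightarrow> p (x, t1) < p (x1, t1) / 2"
    unfolding eventually_nhds_metric by auto
  define r where "r = min (e / 2) (R1 / 2)"
  have r: "r > 0" "r < e" "r \<le> R1 / 2"
    using e R12 by (auto simp: r_def min_def)
  let ?v = "\<lambda>z. - p z"
  have v: "real_polynomial_function ?v"
    using real_polynomial_function_minus[OF poly] .
  have "0 < ?v (x0, t0)"
  proof (rule caloric_pos_propagates[OF v _ r(1) t1(2), where ?x1.0 = x1 and \<kappa> = "- p (x1, t1) / 2"])
    show "time_deriv ?v z = space_laplacian ?v z" for z
      using caloric by (rule caloric_uminus[OF poly])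
    show "0 < - p (x1, t1) / 2"
      using \<open>p (x1, t1) < 0\<close> by simp
    show "- p (x1, t1) / 2 \<le> - p (x, t1)" if "dist x x1 \<le> r" for x
      using e(2)[of x] that r by simp
    show "0 \<le> - p (x, t)" if *: "t1 \<le> t" "t \<le> t0"
      "dist x (x1 + ((t - t1) / (t0 - t1)) *\<^sub>R (x0 - x1)) \<le> r" for x t
    proof -
      define l where "l = (t - t1) / (t0 - t1)"
      have l: "0 \<le> l" "l \<le> 1"
        using * t1 by (auto simp: l_def)
      \<comment> \<open>The centres of the slanted cylinder lie on the segment from
        \<open>x1\<close> to \<open>x0\<close>, hence within \<open>R1 / 2\<close> of
        \<open>x0\<close>; the radius \<open>r\<close> adds at most another
        \<open>R1 / 2\<close>.\<close>
      have "dist (x1 + l *\<^sub>R (x0 - x1)) x0 = norm ((1 - l) *\<^sub>R (x1 - x0))"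
        by (simp add: dist_norm algebra_simps)
      also have "\<dots> \<le> dist x0 x1"
        using l by (simp add: dist_norm norm_minus_commute mult_left_le_one_le)
      finally have "dist x0 x \<le> R1"
        using *(3) r(3) x1 dist_triangle[of x x0 "x1 + l *\<^sub>R (x0 - x1)"] unfolding l_def
        by (simp add: dist_commute)
      then show ?thesis
        using U(3)[OF inU[of x t]] * t1 by (simp add: dist_real_def)
    qed
  qed
  then show False
    using z0 xt by simp
qed

section \<open>Counting nodal domains\<close>

text \<open>Sending each member of \<open>F\<close> to the component of a chosen point of it reaches
  every component, since a component contains a point of some member and that member is
  connected.\<close>

lemma components_card_le:
  assumes "finite F" "\<Union>F = U" "\<And>A. A \<in> F \<Longrightarrow> connected A"
  shows "finite (components U)" "card (components U) \<le> card F"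
proof -
  define f where "f A = connected_component_set U (SOME x. x \<in> A)" for A :: "'a set"
  have "components U \<subseteq> f ` F"
  proof
    fix C assume C: "C \<in> components U"
    then obtain x where x: "x \<in> C" "x \<in> U" "C = connected_component_set U x"
      using in_components_nonempty in_components_subset by (auto simp: components_def)
    then obtain A where A: "A \<in> F" "x \<in> A"
      using assms by auto
    have "(SOME y. y \<in> A) \<in> A"
      using A by (metis someI)
    then have "connected_component U x (SOME y. y \<in> A)"
      using A assms(2,3) by (intro connected_componentI[of A]) auto
    then have "C = f A"
      unfolding f_def x(3) by (simp add: connected_component_eq)
    then show "C \<in> f ` F"
      using A by auto
  qed
  then show "finite (components U)" "card (components U) \<le> card F"
    using assms(1) by (auto intro: finite_subset surj_card_le)
qed

lemma num_nodal_domains_le: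
  assumes "finite F" "\<Union>F = {z. u z \<noteq> 0}" "\<And>A. A \<in> F \<Longrightarrow> connected A" "card F \<le> k"
  shows "num_nodal_domains u \<le> enat k"
  using components_card_le[OF assms(1-3)] assms(4)
  by (simp add: num_nodal_domains_def nodal_domains_def)

lemma connected_same_sign:
  fixes u :: "'a::topological_space \<Rightarrow> real"
  assumes "connected C" "continuous_on C u" "a \<in> C" "b \<in> C" "u a > 0" "u b < 0"
  shows "\<exists>z\<in>C. u z = 0"
proof -
  have "connected (u ` C)"
    using assms connected_continuous_image by blast
  then have "0 \<in> u ` C"
    using assms connectedD_interval[of "u ` C" "u b" "u a" 0] by auto
  then show ?thesis
    by force
qed

lemma num_nodal_domains_uminus: "num_nodal_domains (\<lambda>z. - u z) = num_nodal_domains u"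
  by (simp add: num_nodal_domains_def nodal_domains_def)

lemma num_nodal_domains_ge:
  assumes "S \<subseteq> nodal_domains u" "finite S" "k \<le> card S"
  shows "enat k \<le> num_nodal_domains u"
  using assms card_mono[of "nodal_domains u" S] by (auto simp: num_nodal_domains_def)

text \<open>The component of a positive point stays positive, so \<open>a\<close> and
  \<open>b\<close> lie in different components. A positive point outside the component of
  \<open>a\<close> would produce a third one.\<close>

lemma sign_change_nodal_domains:
  assumes cont: "continuous_on UNIV u" and a: "u a > 0" and b: "u b < 0"
  shows "2 \<le> num_nodal_domains u"
    and "\<not> 3 \<le> num_nodal_domains u \<Longrightarrow> connected {z. u z > 0}"
proof -
  let ?U = "{z. u z \<noteq> 0}"
  let ?c = "connected_component_set ?U"
  have comp: "?c z \<in> nodal_domains u" if "u z \<noteq> 0" for z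
    using that by (auto simp: nodal_domains_def components_def)
  have refl: "z \<in> ?c z" if "u z \<noteq> 0" for z
    using that by (simp add: connected_component_refl_eq)
  have pos: "u y > 0" if "u z > 0" "y \<in> ?c z" for y z
  proof (rule ccontr)
    assume "\<not> u y > 0"
    moreover have sub: "?c z \<subseteq> ?U"
      by (rule connected_component_subset)
    ultimately have "u y < 0"
      using that by fastforce
    then have "\<exists>z\<in>?c z. u z = 0"
      using that refl[of z] continuous_on_subset[OF cont]
      by (intro connected_same_sign[of "?c z" u z y]) auto
    then show False
      using sub by auto
  qed
  have ab: "?c a \<noteq> ?c b"
  proof
    assume "?c a = ?c b"
    then have "b \<in> ?c a"
      using refl[of b] b by simp
    then show False
      using pos[OF a, of b] b by simp
  qed
  then have "enat 2 \<le> num_nodal_domains u"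
    using comp a b by (intro num_nodal_domains_ge[of "{?c a, ?c b}"]) auto
  then show "2 \<le> num_nodal_domains u"
    by (simp add: numeral_eq_enat)
  assume 3: "\<not> 3 \<le> num_nodal_domains u"
  have "y \<in> ?c a" if y: "u y > 0" for y
  proof (rule ccontr)
    assume "y \<notin> ?c a"
    then have "?c y \<noteq> ?c a" "?c y \<noteq> ?c b"
      using refl[of y] refl[of b] pos[OF y, of b] y b by (metis less_irrefl less_asym)+
    then have "enat 3 \<le> num_nodal_domains u"
      using comp a b y ab by (intro num_nodal_domains_ge[of "{?c a, ?c b, ?c y}"]) auto
    then show False
      using 3 by (simp add: numeral_eq_enat)
  qed
  then have "{z. u z > 0} = ?c a"
    using pos[OF a] by auto
  then show "connected {z. u z > 0}"
    by simp
qed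

section \<open>A separation criterion in the plane\<close>

text \<open>If 0 were in an unbounded component of the complement, Borsuk's criterion would give a
  continuous argument \<open>g\<close> of \<open>w\<close> on \<open>K\<close>. The odd function
  \<open>g (- w) - g w\<close> must vanish somewhere on the connected symmetric set
  \<open>K\<close>, and there \<open>w\<close> and \<open>- w\<close> would have the same
  direction.\<close>

lemma symmetric_separates_0:
  fixes K :: "complex set"
  assumes K: "compact K" "connected K" "\<And>w. w \<in> K \<Longrightarrow> - w \<in> K" "0 \<notin> K" "K \<noteq> {}"
  shows "bounded (connected_component_set (- K) 0)"
proof (rule ccontr)
  assume "\<not> ?thesis"
  then obtain c where "homotopic_with_canon (\<lambda>x. True) K (sphere 0 1) (\<lambda>x. inverse (norm (x - 0)) *\<^sub>R (x - 0)) (\<lambda>x. c)"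
    using Borsuk_map_essential_bounded_component[OF K(1,4)] by auto
  then obtain g where g: "continuous_on K g"
    "\<And>x. x \<in> K \<Longrightarrow> inverse (norm x) *\<^sub>R x = exp (\<i> * complex_of_real (g x))"
    using inessential_eq_continuous_logarithm_circle[of K "\<lambda>x. inverse (norm x) *\<^sub>R x"] by auto
  define h where "h w = g (- w) - g w" for w
  have nz: "h w \<noteq> 0" if "w \<in> K" for w
  proof
    assume "h w = 0"
    then have "inverse (norm w) *\<^sub>R (- w) = inverse (norm w) *\<^sub>R w"
      using g(2)[of w] g(2)[of "- w"] K(3) that by (simp add: h_def)
    then show False
      using that K(4) by (auto simp: eq_neg_iff_add_eq_0 neg_eq_iff_add_eq_0)
  qed
  have cont: "continuous_on K h"
    unfolding h_def
    by (intro continuous_intros continuous_on_compose2[OF g(1)] g(1)) (use K in auto)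
  obtain a where a: "a \<in> K"
    using K by auto
  have "h (- a) = - h a"
    by (simp add: h_def)
  then have "\<exists>w\<in>K. h w = 0"
    using connected_same_sign[OF K(2) cont, of a "- a"] connected_same_sign[OF K(2) cont, of "- a" a]
      nz[OF a] K(3)[OF a] a by (cases "h a > 0") auto
  then show False
    using nz by auto
qed

section \<open>Lower bounds\<close>

lemma hcp_polynomial: "hcp d p \<Longrightarrow> real_polynomial_function p"
  and hcp_nonzero: "hcp d p \<Longrightarrow> \<exists>z. p z \<noteq> 0"
  and hcp_caloric: "hcp d p \<Longrightarrow> time_deriv p z = space_laplacian p z"
  and hcp_homogeneous: "hcp d p \<Longrightarrow> l > 0 \<Longrightarrow> p (l *\<^sub>R x, l\<^sup>2 * t) = l ^ d * p (x, t)"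
  by (auto simp: hcp_def simp del: split_paired_All)

lemma hcp_continuous_on: "hcp d p \<Longrightarrow> continuous_on S p"
  by (intro real_polynomial_function_continuous hcp_polynomial)

lemma hcp_uminus:
  assumes "hcp d p"
  shows "hcp d (\<lambda>z. - p z)"
proof -
  note poly = hcp_polynomial[OF assms]
  have "time_deriv (\<lambda>z. - p z) z = space_laplacian (\<lambda>z. - p z) z" for z
    using hcp_caloric[OF assms] by (rule caloric_uminus[OF poly])
  then show ?thesis
    using assms real_polynomial_function_minus[OF poly] by (auto simp: hcp_def)
qed

text \<open>The homogeneity relation is polynomial in \<open>l\<close>, hence extends from \<open>l > 0\<close> to all real \<open>l\<close>.\<close>

lemma hcp_homogeneous_real:
  fixes p :: "(real ^ 'n::finite) \<times> real \<Rightarrow> real"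
  assumes "hcp d p"
  shows "p (l *\<^sub>R x, l\<^sup>2 * t) = l ^ d * p (x, t)"
proof -
  define f where "f l = p (l *\<^sub>R x, l\<^sup>2 * t) - l ^ d * p (x, t)" for l
  have id: "real_polynomial_function (\<lambda>l::real. l)"
    by (intro real_polynomial_function.intros(1) bounded_linear_ident)
  have "polynomial_function (\<lambda>l::real. (l *\<^sub>R x, l\<^sup>2 * t))"
  proof -
    have "(\<lambda>l::real. (l *\<^sub>R x, l\<^sup>2 * t)) = (\<lambda>l. l *\<^sub>R (x, 0) + l *\<^sub>R (l *\<^sub>R (0, t)))"
      by (auto simp: power2_eq_square)
    then show ?thesis
      by (simp only:) (intro polynomial_function_add polynomial_function_mult polynomial_function_const
          polynomial_function_id[unfolded id_def])
  qed
  from real_polynomial_function_compose[OF this hcp_polynomial[OF assms]]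
  have "real_polynomial_function (\<lambda>l. p (l *\<^sub>R x, l\<^sup>2 * t))"
    by (simp add: o_def)
  then have "real_polynomial_function f"
    unfolding f_def
    by (intro real_polynomial_function_diff real_polynomial_function.intros(4,2)
        real_polynomial_function_power id)
  then have "f l = 0"
    by (rule polynomial_zero_on_open[of f "{0<..}" 1]) (auto simp: f_def hcp_homogeneous[OF assms])
  then show ?thesis
    by (simp add: f_def)
qed

lemma hcp_at_0: "hcp d p \<Longrightarrow> d > 0 \<Longrightarrow> p 0 = 0"
  using hcp_homogeneous_real[of d p 0 0 0] by (simp add: zero_prod_def power_0_left)

lemma hcp_sign_change:
  fixes p :: "(real ^ 'n::finite) \<times> real \<Rightarrow> real"
  assumes p: "hcp d p" and d: "d > 0"
  obtains a b where "p a > 0" "p b < 0"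
proof -
  have *: "\<exists>a. q a > 0" if q: "hcp d q" for q :: "(real ^ 'n::finite) \<times> real \<Rightarrow> real"
  proof (rule ccontr)
    assume "\<not> ?thesis"
    then have "q z \<le> 0" for z
      by (meson not_le)
    then have "q z = 0" for z
      using caloric_strong_maximum[OF hcp_polynomial[OF q] hcp_caloric[OF q], of UNIV 0]
        hcp_at_0[OF q d] by auto
    then show False
      using hcp_nonzero[OF q] by auto
  qed
  show ?thesis
    using that *[OF p] *[OF hcp_uminus[OF p]] by auto
qed

section \<open>Two space variables and degree divisible by four\<close>

text \<open>A compact connected subset of \<open>{p < 0}\<close> symmetric under \<open>x \<mapsto> -x\<close> separates \<open>(0, 1)\<close> from \<open>(0, -1)\<close>. To see this
  in the plane, project along the parabolic dilations onto the surface \<open>t = \<bar>x\<bar>\<^sup>4 - 1\<close>, which meets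
  every dilation orbit except the positive time axis exactly once.\<close>

lemma hcp_4_dvd_not_connected:
  fixes p :: "(real ^ 'n::finite) \<times> real \<Rightarrow> real"
  assumes n: "CARD('n) = 2" and p: "hcp d p" and d: "d > 0" "4 dvd d"
    and p01: "p (0, 1) \<ge> 0"
    and conn_pos: "connected {z. p z > 0}" and conn_neg: "connected {z. p z < 0}"
  shows False
proof -
  obtain i j :: 'n where ij: "i \<noteq> j" "UNIV = {i, j}"
    using n by (auto simp: card_2_iff)
  obtain e where e: "d = 4 * e" "e > 0"
    using d by (auto elim!: dvdE)
  have even: "p (- x, t) = p (x, t)" for x t
    using hcp_homogeneous_real[OF p, of "-1" x t] e by simp
  \<comment> \<open>Homogeneity with factor \<open>sqrt t\<close> gives this for
    \<open>t > 0\<close>, and both sides are polynomial in \<open>t\<close>. Divisibility of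
    \<open>d\<close> by 4 enters here: the exponent \<open>2 * e\<close> is even, so both halves of
    the axis carry the same sign.\<close>
  have axis: "p (0, t) = t ^ (2 * e) * p (0, 1)" for t
  proof -
    define f where "f t = p (0, t) - t ^ (2 * e) * p (0, 1)" for t
    have id: "real_polynomial_function (\<lambda>t::real. t)"
      by (intro real_polynomial_function.intros(1) bounded_linear_ident)
    have "polynomial_function (\<lambda>t::real. t *\<^sub>R (0 :: real ^ 'n, 1 :: real))"
      by (intro polynomial_function_mult polynomial_function_const
          polynomial_function_id[unfolded id_def])
    from real_polynomial_function_compose[OF this hcp_polynomial[OF p]]
    have "real_polynomial_function (\<lambda>t. p (0, t))"
      by (simp add: o_def)
    then have "real_polynomial_function f"
      unfolding f_def
      by (intro real_polynomial_function_diff real_polynomial_function.intros(4,2)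
          real_polynomial_function_power id)
    then have "f t = 0"
    proof (rule polynomial_zero_on_open[of f "{0<..}" 1])
      fix t :: real assume "t \<in> {0<..}"
      then have t: "t = (sqrt t)\<^sup>2"
        by simp
      have "p (0, t) = sqrt t ^ d * p (0, 1)"
        using hcp_homogeneous_real[OF p, of "sqrt t" 0 1] t by simp
      also have "sqrt t ^ d = ((sqrt t)\<^sup>2) ^ (2 * e)"
        by (simp add: e flip: power_mult)
      finally show "f t = 0"
        using t by (simp add: f_def)
    qed auto
    then show ?thesis
      by (simp add: f_def)
  qed
  then have axis_nonneg: "p (0, t) \<ge> 0" for t
    using p01 by (metis even_mult_iff even_two_times_div_two zero_le_even_power zero_le_mult_iff dvd_triv_left)
  \<comment> \<open>\<open>cx\<close> and \<open>vec\<close> are mutually inverse isometries between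
    the two-dimensional space and the complex plane, where the separation criterion is
    stated.\<close>
  define cx where "cx x = complex_of_real (x $ i) + \<i> * complex_of_real (x $ j)" for x :: "real ^ 'n"
  define vec where "vec w = (\<chi> k. if k = i then Re w else Im w)" for w :: complex
  have vec_cx: "vec (cx x) = x" for x
    using ij by (auto simp: vec_def cx_def vec_eq_iff)
  have cx_vec: "cx (vec w) = w" for w
    using ij by (auto simp: vec_def cx_def complex_eq_iff)
  have norm_cx: "norm (cx x) = norm x" for x
  proof -
    have "(norm x)\<^sup>2 = (x $ i)\<^sup>2 + (x $ j)\<^sup>2"
      unfolding power2_norm_eq_inner inner_vec_def ij(2) using ij(1) by (simp add: power2_eq_square)
    moreover have "(norm (cx x))\<^sup>2 = (x $ i)\<^sup>2 + (x $ j)\<^sup>2"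
      by (simp add: cx_def cmod_power2)
    ultimately show ?thesis
      by (metis norm_ge_zero power2_eq_iff_nonneg)
  qed
  have norm_vec: "norm (vec w) = norm w" for w
    using norm_cx[of "vec w"] by (simp add: cx_vec)
  have vec_scaleR: "vec (r *\<^sub>R w) = r *\<^sub>R vec w" for r w
    by (simp add: vec_def vec_eq_iff)
  have vec_minus: "vec (- w) = - vec w" for w
    by (simp add: vec_def vec_eq_iff)
  have cont_vec: "continuous_on S vec" for S
  proof -
    have "continuous_on S (\<lambda>w. if k = i then Re w else Im w)" for k
      by (cases "k = i") (auto intro!: continuous_intros)
    then show ?thesis
      unfolding vec_def by (rule continuous_on_vec_lambda)
  qed
  have cont_cx: "continuous_on S (\<lambda>z. cx (fst z))" for S :: "((real^'n) \<times> real) set"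
    unfolding cx_def by (intro continuous_intros)
  \<comment> \<open>Dilating \<open>(x, t)\<close> by \<open>\<mu>\<close> reaches the surface when
    \<open>\<mu> ^ 4 * norm x ^ 4 - 1 = \<mu>\<^sup>2 * t\<close>. This is quadratic in
    \<open>1 / \<mu>\<^sup>2\<close>, with larger root \<open>(q - t) / 2\<close>;
    \<open>\<Omega>\<close> is where that root is positive, and \<open>\<pi>\<close> is the space
    part of the projected point.\<close>
  define q where "q z = sqrt ((snd z)\<^sup>2 + 4 * norm (fst z) ^ 4)" for z :: "(real^'n) \<times> real"
  define \<mu> where "\<mu> z = sqrt (2 / (q z - snd z))" for z
  define \<pi> where "\<pi> z = \<mu> z *\<^sub>R cx (fst z)" for z
  define \<Omega> where "\<Omega> = {z. snd z < q z}"
  have cont_q: "continuous_on S q" for S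
    unfolding q_def by (intro continuous_intros)
  have open_\<Omega>: "open \<Omega>"
    unfolding \<Omega>_def by (intro open_Collect_less continuous_intros cont_q)
  have cont_\<pi>: "continuous_on \<Omega> \<pi>"
    unfolding \<pi>_def \<mu>_def by (intro continuous_intros cont_q cont_cx) (auto simp: \<Omega>_def)
  have q2: "(q z - snd z) * (q z + snd z) = 4 * norm (fst z) ^ 4" for z
    by (simp add: q_def algebra_simps flip: power2_eq_square)
  have \<mu>: "\<mu> z > 0" "(\<mu> z)\<^sup>2 = 2 / (q z - snd z)" if "z \<in> \<Omega>" for z
    using that by (auto simp: \<mu>_def \<Omega>_def)
  have norm_\<pi>: "norm (\<pi> z) ^ 4 - 1 = (\<mu> z)\<^sup>2 * snd z" if "z \<in> \<Omega>" for z
  proof -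
    have "norm (\<pi> z) ^ 4 = ((\<mu> z)\<^sup>2)\<^sup>2 * norm (fst z) ^ 4"
      by (simp add: \<pi>_def power_mult_distrib norm_cx)
    also have "\<dots> = 4 * norm (fst z) ^ 4 / (q z - snd z)\<^sup>2"
      unfolding \<mu>(2)[OF that] by (simp add: power_divide)
    also have "\<dots> = (q z + snd z) / (q z - snd z)"
      using that by (simp add: q2[symmetric] \<Omega>_def power2_eq_square)
    finally show ?thesis
      using that by (simp add: \<mu> \<Omega>_def field_simps)
  qed
  define u where "u w = p (vec w, norm w ^ 4 - 1)" for w
  have u_\<pi>: "u (\<pi> z) = \<mu> z ^ d * p z" if "z \<in> \<Omega>" for z
    using hcp_homogeneous_real[OF p, of "\<mu> z" "fst z" "snd z"] that
    by (simp add: u_def norm_\<pi>) (simp add: \<pi>_def vec_scaleR vec_cx)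
  have cont_u: "continuous_on S u" for S
    unfolding u_def
    by (intro continuous_on_compose2[OF hcp_continuous_on[OF p, of UNIV]] continuous_intros cont_vec) auto
  define A where "A = {w. u w < 0}"
  have not_\<Omega>: "fst z = 0" if "z \<notin> \<Omega>" for z
  proof -
    have "q z \<ge> 0"
      by (simp add: q_def)
    then have "(q z - snd z) * (q z + snd z) \<le> 0"
      using that by (intro mult_nonpos_nonneg) (auto simp: \<Omega>_def)
    then have "norm (fst z) ^ 4 \<le> 0"
      using q2 by simp
    then show ?thesis
      by (metis norm_eq_zero power_eq_0_iff zero_le_even_power antisym even_numeral)
  qed
  have neg_\<Omega>: "z \<in> \<Omega>" if "p z < 0" for z
    using not_\<Omega>[of z] axis_nonneg[of "snd z"] that by (metis not_le prod.collapse)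
  \<comment> \<open>In the plane, the negative set of \<open>u\<close> is the projection of
    \<open>{z. p z < 0}\<close>: points of the surface are fixed, since there
    \<open>q z = norm w ^ 4 + 1\<close> and \<open>\<mu> z = 1\<close>. Hence it is
    connected.\<close>
  have A: "A = \<pi> ` {z. p z < 0}"
  proof (intro set_eqI iffI)
    fix w assume w: "w \<in> A"
    define z where "z = (vec w, norm w ^ 4 - 1)"
    have "q z = sqrt ((norm w ^ 4 + 1)\<^sup>2)"
      by (simp add: q_def z_def norm_vec algebra_simps power2_eq_square)
    then have "q z = norm w ^ 4 + 1"
      by (simp only: real_sqrt_abs) simp
    then have "\<mu> z = 1"
      by (simp add: \<mu>_def z_def)
    then have "\<pi> z = w"
      by (simp add: \<pi>_def z_def cx_vec)
    moreover have "p z < 0"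
      using w by (simp add: A_def u_def z_def)
    ultimately show "w \<in> \<pi> ` {z. p z < 0}"
      by blast
  qed (auto simp: A_def u_\<pi> neg_\<Omega> \<mu> mult_pos_neg)
  have "connected A"
    unfolding A using neg_\<Omega> by (intro connected_continuous_image conn_neg continuous_on_subset[OF cont_\<pi>]) auto
  moreover have "open A"
    unfolding A_def by (intro open_Collect_less cont_u continuous_intros)
  ultimately have "path_connected A"
    by (rule connected_open_path_connected[rotated])
  obtain b where "p b < 0"
    using hcp_sign_change[OF p d(1)] by blast
  then obtain a where a: "a \<in> A"
    using A by auto
  have A_minus: "- w \<in> A" if "w \<in> A" for w
    using that by (simp add: A_def u_def vec_minus even)
  \<comment> \<open>A path inside \<open>A\<close> provides compactness; joining it with its
    reflection provides symmetry, and the shared endpoints keep the union connected.\<close>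
  obtain g where g: "path g" "path_image g \<subseteq> A" "pathstart g = a" "pathfinish g = - a"
    using \<open>path_connected A\<close> a A_minus[OF a] unfolding path_connected_def by blast
  define K where "K = path_image g \<union> uminus ` path_image g"
  have a_g: "a \<in> path_image g" "- a \<in> path_image g"
    using g pathstart_in_path_image pathfinish_in_path_image by metis+
  have K_A: "K \<subseteq> A"
    using g A_minus by (auto simp: K_def)
  have "0 \<notin> A"
    using axis_nonneg[of "-1"] by (simp add: A_def u_def) (simp add: vec_def zero_vec_def[symmetric] cong: if_cong)
  have "bounded (connected_component_set (- K) 0)"
  proof (rule symmetric_separates_0)
    show "compact K"
      unfolding K_def using g by (intro compact_Un compact_continuous_image continuous_intros) auto
    have "connected (uminus ` path_image g)"
      using g by (intro connected_continuous_image continuous_intros) auto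
    then show "connected K"
      unfolding K_def using g a_g by (intro connected_Un connected_path_image) auto
    show "- w \<in> K" if "w \<in> K" for w
      using that by (auto simp: K_def)
    show "0 \<notin> K" "K \<noteq> {}"
      using K_A \<open>0 \<notin> A\<close> a_g by (auto simp: K_def)
  qed
  then obtain R where R: "R > 0" "\<And>w. w \<in> connected_component_set (- K) 0 \<Longrightarrow> norm w \<le> R"
    by (auto simp: bounded_pos)
  define C where "C = connected_component_set (- K) 0"
  have "closed K"
    unfolding K_def using g by (intro compact_imp_closed compact_Un compact_continuous_image continuous_intros) auto
  then have "open (- K)"
    by (rule open_Compl)
  then have "open C"
    unfolding C_def by (rule open_connected_component)
  have "closedin (top_of_set (- K)) C"
    unfolding C_def by (rule closedin_connected_component)
  then have "openin (top_of_set (- K)) (- K - C)"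
    by (simp add: openin_diff)
  then have "open (- K - C)"
    using \<open>open (- K)\<close> openin_open_trans by blast
  \<comment> \<open>\<open>E\<close> is a neighbourhood of the open positive time axis, where
    \<open>\<pi>\<close> is not usable. Off the axis, \<open>norm (\<pi> z)\<close> squared equals
    \<open>(q z + snd z) / (2 * (norm (fst z))\<^sup>2)\<close>, so on \<open>E\<close> it exceeds
    \<open>R\<^sup>2\<close> and \<open>\<pi>\<close> avoids the bounded component
    \<open>C\<close>.\<close>
  define E where "E = {z. 2 * R\<^sup>2 * (norm (fst z))\<^sup>2 < q z + snd z}"
  define V where "V = \<Omega> \<inter> \<pi> -` C"
  define W where "W = E \<union> (\<Omega> \<inter> \<pi> -` (- K - C))"
  have "open V"
    unfolding V_def by (rule continuous_open_preimage[OF cont_\<pi> open_\<Omega> \<open>open C\<close>])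
  have "open E"
    unfolding E_def by (intro open_Collect_less continuous_intros cont_q)
  then have "open W"
    unfolding W_def by (intro open_Un continuous_open_preimage[OF cont_\<pi> open_\<Omega> \<open>open (- K - C)\<close>])
  have VE: "V \<inter> E = {}"
  proof (rule ccontr)
    assume "V \<inter> E \<noteq> {}"
    then obtain z where z: "z \<in> \<Omega>" "\<pi> z \<in> C" "z \<in> E"
      by (auto simp: V_def)
    define \<rho> where "\<rho> = (norm (fst z))\<^sup>2"
    have "(norm (\<pi> z))\<^sup>2 \<le> R\<^sup>2"
      using R(2)[of "\<pi> z"] z by (simp add: C_def power_mono)
    moreover have "(norm (\<pi> z))\<^sup>2 = 2 * \<rho> / (q z - snd z)"
      using z by (simp add: \<pi>_def power_mult_distrib \<mu> norm_cx \<rho>_def)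
    ultimately have 1: "2 * \<rho> \<le> R\<^sup>2 * (q z - snd z)"
      using z by (simp add: \<Omega>_def field_simps)
    have 2: "2 * R\<^sup>2 * \<rho> < q z + snd z"
      using z by (simp add: E_def \<rho>_def)
    have 3: "(q z - snd z) * (q z + snd z) = 4 * \<rho>\<^sup>2"
      using q2 by (simp add: \<rho>_def)
    have "(q z - snd z) * (2 * R\<^sup>2 * \<rho>) < (q z - snd z) * (q z + snd z)"
      using 2 z by (simp add: \<Omega>_def)
    moreover have "2 * \<rho> * (2 * \<rho>) \<le> R\<^sup>2 * (q z - snd z) * (2 * \<rho>)"
      using 1 by (intro mult_right_mono) (auto simp: \<rho>_def)
    ultimately show False
      unfolding 3 by (simp add: power2_eq_square algebra_simps)
  qed
  have "C \<inter> (- K - C) = {}" by auto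
  then have VW: "V \<inter> W = {}"
    using VE by (auto simp: W_def V_def)
  \<comment> \<open>Where \<open>p\<close> is positive, \<open>\<pi>\<close> misses \<open>K\<close>
    because \<open>u\<close> is negative on \<open>K\<close>; outside \<open>\<Omega>\<close> only
    points of the positive time axis remain, and these lie in \<open>E\<close>.\<close>
  have cover: "z \<in> V \<union> W" if "p z > 0" for z
  proof (cases "z \<in> \<Omega>")
    case True
    then have "\<pi> z \<notin> K"
      using that K_A u_\<pi>[OF True] \<mu>(1)[OF True] by (auto simp: A_def subset_iff) (metis less_asym mult_pos_pos zero_less_power)
    then show ?thesis
      using True by (auto simp: V_def W_def)
  next
    case False
    then have "snd z \<ge> \<bar>snd z\<bar>" "fst z = 0"
      using not_\<Omega>[OF False] by (auto simp: \<Omega>_def q_def)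
    moreover have "snd z \<noteq> 0"
      using that hcp_at_0[OF p d(1)] \<open>fst z = 0\<close> by (metis less_irrefl prod.collapse zero_prod_def)
    ultimately have "z \<in> E"
      by (auto simp: E_def q_def)
    then show ?thesis
      by (auto simp: W_def)
  qed
  have N: "(0, 1) \<in> W"
    by (auto simp: W_def E_def q_def)
  have "\<pi> (0, -1) = 0"
    by (simp add: \<pi>_def cx_def)
  moreover have "0 \<in> C"
    using K_A \<open>0 \<notin> A\<close> by (auto simp: C_def connected_component_refl_eq)
  ultimately have S: "(0, -1) \<in> V"
    by (simp add: V_def \<Omega>_def q_def)
  \<comment> \<open>Connectedness forces \<open>{z. p z > 0}\<close> to miss \<open>V\<close> or
    \<open>W\<close>. Each contains a point of the time axis, where \<open>p\<close> is nonnegative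
    and would thus have a local maximum with value 0.\<close>
  have contra: False if "open U" "(0, s) \<in> U" "\<And>z. z \<in> U \<Longrightarrow> p z \<le> 0" for U s
  proof -
    have "p (0, s) = 0"
      using that axis_nonneg[of s] by force
    then have "p z = 0" for z
      using caloric_strong_maximum[OF hcp_polynomial[OF p] hcp_caloric[OF p] that] by blast
    then show False
      using hcp_nonzero[OF p] by blast
  qed
  have "{z. p z > 0} \<inter> V = {} \<or> {z. p z > 0} \<inter> W = {}"
    using connectedD[OF conn_pos \<open>open V\<close> \<open>open W\<close>] VW cover by blast
  then show False
  proof
    assume "{z. p z > 0} \<inter> V = {}"
    then show False
      using contra[OF \<open>open V\<close> S] by (force simp: not_less[symmetric])
  next
    assume "{z. p z > 0} \<inter> W = {}"
    then show False
      using contra[OF \<open>open W\<close> N] by (force simp: not_less[symmetric])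
  qed
qed

section \<open>Heat polynomials\<close>

text \<open>The three-term recursion of the polynomials with exponential generating function
  \<open>exp (x * s + t * s\<^sup>2)\<close> in \<open>s\<close>. At \<open>t = -1\<close> they are
  the physicists' Hermite polynomials in \<open>x / 2\<close>.\<close>

fun heat :: "nat \<Rightarrow> real \<Rightarrow> real \<Rightarrow> real" where
  "heat 0 x t = 1"
| "heat (Suc 0) x t = x"
| "heat (Suc (Suc n)) x t = x * heat (Suc n) x t + 2 * real (Suc n) * t * heat n x t"

text \<open>The Appell property. For \<open>n = 0\<close> the truncated index \<open>n - 1\<close>
  is harmless because of the factor \<open>real n\<close>.\<close>

lemma heat_has_derivative_x:
  "((\<lambda>x. heat n x t) has_real_derivative real n * heat (n - 1) x t) (at x)"
proof (induction n x t rule: heat.induct)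
  case (3 n x t)
  have "((\<lambda>x. heat (Suc (Suc n)) x t) has_real_derivative
      heat (Suc n) x t + x * (real (Suc n) * heat n x t)
      + 2 * real (Suc n) * t * (real n * heat (n - 1) x t)) (at x)"
    using 3 by (auto intro!: derivative_eq_intros)
  also have "heat (Suc n) x t + x * (real (Suc n) * heat n x t)
      + 2 * real (Suc n) * t * (real n * heat (n - 1) x t) = real (Suc (Suc n)) * heat (Suc n) x t"
    by (cases n) (auto simp: algebra_simps)
  finally show ?case
    by simp
qed (auto intro!: derivative_eq_intros)

text \<open>The value agrees with the second derivative in \<open>x\<close>, which is the heat
  equation for \<open>heat n\<close>. Truncated indices again come with a vanishing factor.\<close>

lemma heat_has_derivative_t:
  "((\<lambda>t. heat n x t) has_real_derivative real n * real (n - 1) * heat (n - 2) x t) (at t)"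
proof (induction n x t rule: heat.induct)
  case (3 n x t)
  have "((\<lambda>t. heat (Suc (Suc n)) x t) has_real_derivative
      x * (real (Suc n) * real n * heat (Suc n - 2) x t)
      + (2 * real (Suc n) * heat n x t
      + 2 * real (Suc n) * t * (real n * real (n - 1) * heat (n - 2) x t))) (at t)"
    using 3 by (auto intro!: derivative_eq_intros)
  also have "x * (real (Suc n) * real n * heat (Suc n - 2) x t)
      + (2 * real (Suc n) * heat n x t
      + 2 * real (Suc n) * t * (real n * real (n - 1) * heat (n - 2) x t))
      = real (Suc (Suc n)) * real (Suc n) * heat n x t"
  proof -
    consider "n = 0" | "n = 1" | m where "n = Suc (Suc m)"
      by (metis One_nat_def not0_implies_Suc)
    then show ?thesis
      by cases (auto simp: algebra_simps)
  qed
  finally show ?case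
    by simp
qed (auto intro!: derivative_eq_intros)

lemma heat_homogeneous: "heat n (l * x) (l\<^sup>2 * t) = l ^ n * heat n x t"
  by (induction n x t rule: heat.induct) (auto simp: algebra_simps power2_eq_square)

lemma heat_minus: "heat n (- x) t = (-1) ^ n * heat n x t"
  using heat_homogeneous[of n "-1" x t] by simp

lemma heat_even_minus: "even n \<Longrightarrow> heat n (- x) t = heat n x t"
  and heat_odd_minus: "odd n \<Longrightarrow> heat n (- x) t = - heat n x t"
  by (simp_all add: heat_minus)

lemma continuous_on_heat [continuous_intros]:
  fixes f g :: "'a::topological_space \<Rightarrow> real"
  assumes f: "continuous_on S f" and g: "continuous_on S g"
  shows "continuous_on S (\<lambda>z. heat n (f z) (g z))"
proof (induction n rule: induct_nat_012)
  case (ge2 n)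
  then show ?case
    using f g by (auto intro!: continuous_intros)
qed (use f in auto)

lemma real_polynomial_function_heat:
  assumes f: "real_polynomial_function f" and g: "real_polynomial_function g"
  shows "real_polynomial_function (\<lambda>z. heat n (f z) (g z))"
proof (induction n rule: induct_nat_012)
  case (ge2 n)
  have "real_polynomial_function (\<lambda>z. f z * heat (Suc n) (f z) (g z) + (2 * real (Suc n)) * g z * heat n (f z) (g z))"
    by (intro real_polynomial_function.intros(2-4) ge2 f g)
  then show ?case
    by simp
qed (use f in \<open>auto intro: real_polynomial_function.intros(2)\<close>)

lemma heat_pos: "x > 0 \<Longrightarrow> t \<ge> 0 \<Longrightarrow> heat n x t > 0"
  by (induction n x t rule: heat.induct) (auto intro!: add_pos_nonneg)

lemma heat_even_nonneg:
  assumes "even n" "t \<ge> 0"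
  shows "heat n x t \<ge> 0"
proof -
  consider "x > 0" | "x < 0" | "x = 0" by linarith
  then show ?thesis
  proof cases
    case 1
    then show ?thesis using heat_pos[of x t n] assms by simp
  next
    case 2
    then show ?thesis using heat_pos[of "-x" t n] assms by (simp add: heat_minus)
  next
    case 3
    then show ?thesis using assms
    proof (induction n rule: induct_nat_012)
    qed auto
  qed
qed

lemma heat_even_at_0_t1: "even n \<Longrightarrow> heat n 0 1 > 0"
  by (induction n rule: induct_nat_012) auto

text \<open>At \<open>x = 0\<close> only the second term of the recursion survives, contributing one
  factor \<open>t\<close> per two degrees. The sign at negative times therefore alternates with
  \<open>k\<close>.\<close>

lemma heat_even_at_0: "heat (2 * k) 0 t = t ^ k * heat (2 * k) 0 1"
  by (induction k) auto

lemma heat_odd_mono: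
  assumes "odd n" "t \<ge> 0" "x \<le> y"
  shows "heat n x t \<le> heat n y t"
proof (rule DERIV_nonneg_imp_nondecreasing[OF assms(3)])
  fix u
  have "real n * heat (n - 1) u t \<ge> 0"
    using assms heat_even_nonneg[of "n - 1" t u] by simp
  then show "\<exists>c. ((\<lambda>x. heat n x t) has_real_derivative c) (at u) \<and> 0 \<le> c"
    using heat_has_derivative_x by blast
qed

text \<open>For \<open>t \<noteq> 0\<close> a common zero of two consecutive polynomials would
  descend through the recursion to \<open>heat 0 = 1\<close>. By the Appell property this makes the
  zeros in \<open>x\<close> simple.\<close>

lemma heat_simple_zero:
  assumes "heat (Suc n) x t = 0" "t \<noteq> 0"
  shows "heat n x t \<noteq> 0"
  using assms by (induction n) auto

section \<open>Growth of heat polynomials\<close>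

text \<open>By homogeneity \<open>heat n y t = y ^ n * heat n 1 (t / y\<^sup>2)\<close>, and the
  last factor is close to \<open>heat n 1 0 = 1\<close> once \<open>y\<close> is large compared with
  \<open>T\<close>.\<close>

lemma heat_lower_bound:
  obtains Y where "Y \<ge> 1" "\<And>y t. y \<ge> Y \<Longrightarrow> \<bar>t\<bar> \<le> T \<Longrightarrow> y ^ n / 2 \<le> heat n y t"
proof -
  have h0: "heat n 1 0 = 1"
    by (induction n rule: induct_nat_012) auto
  have "continuous_on UNIV (\<lambda>t. heat n 1 t)"
    by (intro continuous_intros)
  then have "isCont (\<lambda>t. heat n 1 t) 0"
    by (simp add: continuous_on_eq_continuous_at)
  then have "((\<lambda>t. heat n 1 t) \<longlongrightarrow> 1) (nhds 0)"
    using h0 by (simp add: isCont_def tendsto_nhds_iff)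
  then have "\<forall>\<^sub>F t in nhds 0. heat n 1 t > 1 / 2"
    by (intro order_tendstoD) auto
  then obtain e where e: "e > 0" "\<And>t. \<bar>t\<bar> < e \<Longrightarrow> heat n 1 t > 1 / 2"
    unfolding eventually_nhds_metric by auto
  define Y where "Y = 1 + \<bar>T\<bar> / e"
  have "\<bar>T\<bar> / e \<ge> 0"
    using e by simp
  have "y ^ n / 2 \<le> heat n y t" if y: "y \<ge> Y" and t: "\<bar>t\<bar> \<le> T" for y t
  proof -
    have y1: "y \<ge> 1" "\<bar>T\<bar> / e < y"
      using y \<open>\<bar>T\<bar> / e \<ge> 0\<close> unfolding Y_def by linarith+
    note y1(2)
    also have "y \<le> y\<^sup>2"
      using y1 by (simp add: power2_eq_square)
    finally have "\<bar>T\<bar> < e * y\<^sup>2"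
      using e by (simp add: field_simps)
    then have "\<bar>t / y\<^sup>2\<bar> < e"
      using t y1 by (simp add: field_simps abs_divide)
    then have "heat n 1 (t / y\<^sup>2) > 1 / 2"
      by (rule e)
    then have "y ^ n * (1 / 2) \<le> y ^ n * heat n 1 (t / y\<^sup>2)"
      using y1 by (intro mult_left_mono) auto
    moreover have "heat n y t = y ^ n * heat n 1 (t / y\<^sup>2)"
      using heat_homogeneous[of n y 1 "t / y\<^sup>2"] y1 by simp
    ultimately show ?thesis
      by simp
  qed
  moreover have "Y \<ge> 1"
    using \<open>\<bar>T\<bar> / e \<ge> 0\<close> by (simp add: Y_def)
  ultimately show ?thesis
    using that by blast
qed

lemma heat_large:
  assumes "n \<ge> 1"
  obtains Y where "Y \<ge> 1" "\<And>y t. y \<ge> Y \<Longrightarrow> \<bar>t\<bar> \<le> T \<Longrightarrow> c \<le> heat n y t"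
proof -
  obtain Y where Y: "Y \<ge> 1" "\<And>y t. y \<ge> Y \<Longrightarrow> \<bar>t\<bar> \<le> T \<Longrightarrow> y ^ n / 2 \<le> heat n y t"
    using heat_lower_bound by blast
  have "c \<le> heat n y t" if "y \<ge> max Y (2 * c)" "\<bar>t\<bar> \<le> T" for y t
  proof -
    have "y \<le> y ^ n"
      using that Y(1) assms power_increasing[of 1 n y] by simp
    then show ?thesis
      using that Y(2)[of y t] by simp
  qed
  then show ?thesis
    using that[of "max Y (2 * c)"] Y(1) by auto
qed

section \<open>Connectedness of a fibration\<close>

text \<open>The derivative in \<open>y\<close> has even degree, so \<open>heat m y (-1)\<close> is
  nondecreasing on both sides of a compact interval, on which it is bounded by some
  \<open>B\<close>. Levels of absolute value at least \<open>B + 1\<close> are not met on that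
  interval, which makes their superlevel sets upward closed.\<close>

lemma heat_odd_superlevel_upward:
  assumes "odd m"
  obtains M where "M > 0"
    "\<And>c y y'. \<bar>c\<bar> \<ge> M \<Longrightarrow> c < heat m y (-1) \<Longrightarrow> y \<le> y' \<Longrightarrow> c < heat m y' (-1)"
proof -
  obtain a where a: "a \<ge> 1" "\<And>y. y \<ge> a \<Longrightarrow> 0 \<le> heat (m - 1) y (-1)"
  proof (rule heat_lower_bound[of 1 "m - 1"])
    fix Y :: real assume Y: "1 \<le> Y" "\<And>y t. Y \<le> y \<Longrightarrow> \<bar>t\<bar> \<le> 1 \<Longrightarrow> y ^ (m - 1) / 2 \<le> heat (m - 1) y t"
    have "0 \<le> heat (m - 1) y (-1)" if "y \<ge> Y" for y
      using Y(1) that by (intro order.trans[OF _ Y(2)]) auto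
    then show thesis
      using that Y(1) by blast
  qed
  have nn: "0 \<le> heat (m - 1) y (-1)" if "a \<le> \<bar>y\<bar>" for y
    using a(2)[of y] a(2)[of "- y"] that assms by (cases "y \<ge> 0") (auto simp: heat_even_minus)
  have mono: "heat m y (-1) \<le> heat m y' (-1)" if "y \<le> y'" "y' \<le> - a \<or> a \<le> y" for y y'
  proof (rule DERIV_nonneg_imp_nondecreasing[OF that(1)])
    fix u assume "y \<le> u" "u \<le> y'"
    then have "real m * heat (m - 1) u (-1) \<ge> 0"
      using that(2) a(1) by (intro mult_nonneg_nonneg nn) auto
    then show "\<exists>c. ((\<lambda>x. heat m x (-1)) has_real_derivative c) (at u) \<and> 0 \<le> c"
      using heat_has_derivative_x by blast
  qed
  have "compact ((\<lambda>y. heat m y (-1)) ` {-a..a})"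
    by (intro compact_continuous_image continuous_intros) auto
  then obtain B where "\<forall>z\<in>(\<lambda>y. heat m y (-1)) ` {-a..a}. norm z \<le> B"
    by (meson compact_imp_bounded bounded_iff)
  then have B: "\<bar>heat m y (-1)\<bar> \<le> B" if "\<bar>y\<bar> \<le> a" for y
    using that by (simp add: abs_le_iff)
  have "c < heat m y' (-1)" if c: "B + 1 \<le> \<bar>c\<bar>" "c < heat m y (-1)" and y: "y \<le> y'" for c y y'
  proof -
    consider "y' \<le> - a \<or> a \<le> y" | "y < a" "- a < y'" by linarith
    then show ?thesis
    proof cases
      case 1
      then show ?thesis
        using mono[OF y] c by linarith
    next
      case 2
      \<comment> \<open>Since \<open>y\<close> lies left of \<open>a\<close>, the level satisfies
        \<open>c < B\<close>, so a large absolute value means \<open>c \<le> - B - 1\<close>; since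
        \<open>y'\<close> lies right of \<open>- a\<close>, its value is at least
        \<open>- B\<close>.\<close>
      have "heat m y (-1) \<le> B"
      proof (cases "y \<le> - a")
        case True
        then show ?thesis
          using B[of "- a"] mono[of y "- a"] a(1) by simp
      next
        case False
        then have "\<bar>y\<bar> \<le> a"
          using 2 by linarith
        then show ?thesis
          using B[of y] by linarith
      qed
      then have "c \<le> - B - 1"
        using c by linarith
      moreover have "- B \<le> heat m y' (-1)"
      proof (cases "a \<le> y'")
        case True
        then show ?thesis
          using B[of a] mono[of a y'] a(1) by simp
      next
        case False
        then have "\<bar>y'\<bar> \<le> a"
          using 2 by linarith
        then show ?thesis
          using B[of y'] by linarith
      qed
      ultimately show ?thesis
        by linarith
    qed
  qed
  moreover have "B + 1 > 0"
    using B[of 0] a by auto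
  ultimately show ?thesis
    using that by blast
qed

text \<open>Maximise \<open>\<phi>\<close> over the component of \<open>x\<close> in the compact
  part of the band where \<open>\<phi>\<close> is at least \<open>\<phi> x\<close>. Below level
  \<open>\<delta>\<close> the nonzero derivative at the maximiser would allow a short step upwards
  within that same component.\<close>

lemma escape_to_level:
  fixes \<phi> \<phi>' :: "real \<Rightarrow> real"
  assumes D: "open D" and der: "\<And>x. x \<in> D \<Longrightarrow> (\<phi> has_real_derivative \<phi>' x) (at x)"
    and compact: "compact {x \<in> D. \<bar>\<phi> x\<bar> \<le> \<delta>}"
    and crit: "\<And>x. x \<in> D \<Longrightarrow> \<bar>\<phi> x\<bar> \<le> \<delta> \<Longrightarrow> \<phi>' x \<noteq> 0"
    and x: "x \<in> D" "\<bar>\<phi> x\<bar> \<le> \<delta>"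
  obtains S x' where "connected S" "x \<in> S" "x' \<in> S" "S \<subseteq> D" "\<And>w. w \<in> S \<Longrightarrow> \<phi> x \<le> \<phi> w" "\<phi> x' = \<delta>"
proof -
  have cont: "continuous_on S \<phi>" if "S \<subseteq> D" for S
    using der that by (intro continuous_at_imp_continuous_on ballI DERIV_isCont) blast
  define Q where "Q = {x \<in> D. \<bar>\<phi> x\<bar> \<le> \<delta>} \<inter> \<phi> -` {\<phi> x..}"
  have "closed Q"
    unfolding Q_def
    by (intro continuous_closed_preimage cont compact_imp_closed[OF compact]) auto
  then have Q: "compact Q"
    using compact_Int_closed[OF compact, of Q] by (auto simp: Q_def Int_assoc[symmetric])
  define S where "S = connected_component_set Q x"
  have xQ: "x \<in> Q"
    using x by (auto simp: Q_def)
  have xS: "x \<in> S"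
    using xQ by (simp add: S_def connected_component_refl_eq)
  have SQ: "S \<subseteq> Q"
    unfolding S_def by (rule connected_component_subset)
  have "closed S"
    unfolding S_def by (rule closed_connected_component[OF \<open>closed Q\<close>])
  then have "compact S"
    using Q SQ by (metis compact_Int_closed inf.absorb2)
  moreover have "S \<noteq> {}" "continuous_on S \<phi>"
    using xS SQ by (auto simp: Q_def intro!: cont)
  ultimately obtain v where v: "v \<in> S" "\<And>w. w \<in> S \<Longrightarrow> \<phi> w \<le> \<phi> v"
    by (metis continuous_attains_sup)
  have vD: "v \<in> D" "\<bar>\<phi> v\<bar> \<le> \<delta>" "\<phi> x \<le> \<phi> v"
    using v SQ by (auto simp: Q_def)
  have "\<phi> v = \<delta>"
  proof (rule ccontr)
    assume "\<phi> v \<noteq> \<delta>"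
    then have "\<phi> v < \<delta>"
      using vD by linarith
    have "open (D \<inter> \<phi> -` {..<\<delta>})"
      by (intro continuous_open_preimage cont D) auto
    moreover have "v \<in> D \<inter> \<phi> -` {..<\<delta>}"
      using vD \<open>\<phi> v < \<delta>\<close> by simp
    ultimately obtain e where e: "e > 0" "ball v e \<subseteq> D \<inter> \<phi> -` {..<\<delta>}"
      using open_contains_ball by blast
    have "\<exists>h. \<bar>h\<bar> < e \<and> \<phi> v < \<phi> (v + h) \<and> (\<forall>w\<in>closed_segment v (v + h). \<phi> v \<le> \<phi> w)"
    proof (cases "\<phi>' v > 0")
      case True
      then obtain d where d: "d > 0" "\<And>h. 0 < h \<Longrightarrow> h < d \<Longrightarrow> \<phi> v < \<phi> (v + h)"
        using DERIV_pos_inc_right[OF der[OF vD(1)]] by blast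
      define h where "h = min d e / 2"
      have h: "0 < h" "h < d" "h < e"
        using d e by (auto simp: h_def min_def)
      have "\<phi> v \<le> \<phi> w" if "w \<in> closed_segment v (v + h)" for w
        using d(2)[of "w - v"] that h by (cases "w = v") (auto simp: closed_segment_eq_real_ivl)
      then show ?thesis
        using d(2)[of h] h by (intro exI[of _ h]) auto
    next
      case False
      then have "\<phi>' v < 0"
        using crit[OF vD(1,2)] by linarith
      then obtain d where d: "d > 0" "\<And>h. 0 < h \<Longrightarrow> h < d \<Longrightarrow> \<phi> v < \<phi> (v - h)"
        using DERIV_neg_dec_left[OF der[OF vD(1)]] by blast
      define h where "h = min d e / 2"
      have h: "0 < h" "h < d" "h < e"
        using d e by (auto simp: h_def min_def)
      have "\<phi> v \<le> \<phi> w" if "w \<in> closed_segment v (v + - h)" for w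
        using d(2)[of "v - w"] that h by (cases "w = v") (auto simp: closed_segment_eq_real_ivl)
      then show ?thesis
        using d(2)[of h] h by (intro exI[of _ "- h"]) auto
    qed
    then obtain h where h: "\<bar>h\<bar> < e" "\<phi> v < \<phi> (v + h)" "\<And>w. w \<in> closed_segment v (v + h) \<Longrightarrow> \<phi> v \<le> \<phi> w"
      by blast
    have "closed_segment v (v + h) \<subseteq> Q"
    proof
      fix w assume w: "w \<in> closed_segment v (v + h)"
      then have "dist v w < e"
        using h(1) by (auto simp: closed_segment_eq_real_ivl dist_real_def split: if_splits)
      then have "w \<in> D" "\<phi> w < \<delta>"
        using e(2) by auto
      then show "w \<in> Q"
        using h(3)[OF w] vD by (auto simp: Q_def)
    qed
    then have "connected_component Q v (v + h)"
      by (intro connected_componentI[of "closed_segment v (v + h)"]) auto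
    then have "v + h \<in> S"
      using v(1) by (auto simp: S_def intro: connected_component_trans)
    then show False
      using v(2) h(2) by fastforce
  qed
  then show ?thesis
    using that[of S v] v(1) xS SQ by (auto simp: S_def Q_def)
qed


text \<open>Below the level \<open>t = 0\<close> it suffices to look at \<open>t = -1\<close>. There the fibre \<open>{y. \<phi> + \<epsilon> H > 0}\<close> is an
  upward ray unless \<open>\<bar>\<phi>\<bar>\<close> is small, and in that case moving \<open>x\<close> in the direction in which \<open>\<phi>\<close>
  increases leads to a point where \<open>\<phi>\<close> is not small.\<close>

lemma connected_positive_fibration:
  fixes \<phi> :: "real \<Rightarrow> real \<Rightarrow> real" and D :: "real set"
  assumes D: "open D" "convex D"
    and m: "odd m"
    and M: "M > 0" "\<And>c y y'. \<bar>c\<bar> \<ge> M \<Longrightarrow> c < heat m y (-1) \<Longrightarrow> y \<le> y' \<Longrightarrow> c < heat m y' (-1)"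
    and \<delta>: "\<delta> > 0" "\<epsilon> = \<delta> / M"
    and cont: "continuous_on (D \<times> UNIV) (\<lambda>(x, t). \<phi> x t)"
    and hom: "\<And>l x. l > 0 \<Longrightarrow> x \<in> D \<Longrightarrow> l * x \<in> D"
      "\<And>l x t. l > 0 \<Longrightarrow> x \<in> D \<Longrightarrow> \<phi> (l * x) (l\<^sup>2 * t) = l ^ m * \<phi> x t"
    and der: "\<And>x. x \<in> D \<Longrightarrow> ((\<lambda>x. \<phi> x (-1)) has_real_derivative \<phi>' x) (at x)"
    and compact: "compact {x \<in> D. \<bar>\<phi> x (-1)\<bar> \<le> \<delta>}"
    and crit: "\<And>x. x \<in> D \<Longrightarrow> \<bar>\<phi> x (-1)\<bar> \<le> \<delta> \<Longrightarrow> \<phi>' x \<noteq> 0"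
  shows "connected {(x, y, t). x \<in> D \<and> \<phi> x t + \<epsilon> * heat m y t > 0}" (is "connected ?Q")
proof -
  have \<epsilon>: "\<epsilon> > 0"
    using \<delta> M by simp
  have m1: "m \<ge> 1"
    using m by (cases m) auto
  \<comment> \<open>Points from which \<open>y\<close> can be raised without limit; every point is
    joined to one of these, and these are then joined to each other at great height.\<close>
  define far where "far x y t \<longleftrightarrow> x \<in> D \<and> (\<forall>y'\<ge>y. \<phi> x t + \<epsilon> * heat m y' t > 0)" for x y t
  have slice: "\<exists>S x'. connected S \<and> x \<in> S \<and> x' \<in> S \<and> S \<subseteq> D \<and>
      (\<forall>w\<in>S. \<phi> w (-1) + \<epsilon> * heat m y (-1) > 0) \<and> far x' y (-1)"
    if x: "x \<in> D" and pos: "\<phi> x (-1) + \<epsilon> * heat m y (-1) > 0" for x y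
  proof -
    have far: "far x' y (-1)"
      if x': "x' \<in> D" "\<bar>\<phi> x' (-1)\<bar> \<ge> \<delta>" and pos: "\<phi> x' (-1) + \<epsilon> * heat m y (-1) > 0" for x'
    proof -
      \<comment> \<open>Positivity at \<open>y'\<close> means that \<open>heat m y' (-1)\<close>
        exceeds \<open>c\<close>, and the choice \<open>\<epsilon> = \<delta> / M\<close> turns the
        bound \<open>\<delta>\<close> for \<open>\<phi>\<close> into the bound \<open>M\<close> for
        \<open>c\<close>.\<close>
      define c where "c = - \<phi> x' (-1) / \<epsilon>"
      have iff: "\<phi> x' (-1) + \<epsilon> * heat m y' (-1) > 0 \<longleftrightarrow> c < heat m y' (-1)" for y'
        using \<epsilon> by (auto simp: c_def field_simps)
      have "M = \<delta> / \<epsilon>"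
        using \<delta> M by simp
      then have "M \<le> \<bar>c\<bar>"
        using x'(2) \<epsilon> by (simp add: c_def abs_divide divide_right_mono)
      then show ?thesis
        using M(2)[of c y] pos x'(1) unfolding far_def iff by auto
    qed
    show ?thesis
    proof (cases "\<bar>\<phi> x (-1)\<bar> \<le> \<delta>")
      case True
      obtain S x' where S: "connected S" "x \<in> S" "x' \<in> S" "S \<subseteq> D"
        "\<And>w. w \<in> S \<Longrightarrow> \<phi> x (-1) \<le> \<phi> w (-1)" "\<phi> x' (-1) = \<delta>"
        using escape_to_level[OF D(1) der compact crit x True] by metis
      have "\<forall>w\<in>S. \<phi> w (-1) + \<epsilon> * heat m y (-1) > 0"
        using S(5) pos by fastforce
      then show ?thesis
        using S far[of x'] by (intro exI[of _ S] exI[of _ x']) auto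
    next
      case False
      then show ?thesis
        using far[OF x _ pos] x pos by (intro exI[of _ "{x}"] exI[of _ x]) auto
    qed
  qed
  have to_far: "\<exists>x' y'. far x' y' t \<and> connected_component ?Q (x, y, t) (x', y', t)"
    if q: "(x, y, t) \<in> ?Q" for x y t
  proof (cases "t \<ge> 0")
    case True
    have "far x y t"
      unfolding far_def
    proof (intro conjI allI impI)
      fix y' assume "y \<le> y'"
      then have "\<epsilon> * heat m y t \<le> \<epsilon> * heat m y' t"
        using heat_odd_mono[OF m True] \<epsilon> by simp
      then show "0 < \<phi> x t + \<epsilon> * heat m y' t"
        using q by simp
    qed (use q in simp)
    then show ?thesis
      using q by (meson connected_component_refl)
  next
    case False
    \<comment> \<open>Dilation by \<open>l\<close> takes time -1 to time \<open>t\<close>; both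
      summands have degree \<open>m\<close>, so signs are preserved.\<close>
    define l where "l = sqrt (- t)"
    have l: "l > 0" "l\<^sup>2 * (-1) = t"
      using False by (auto simp: l_def)
    have scale: "\<phi> x t + \<epsilon> * heat m y t = l ^ m * (\<phi> (x / l) (-1) + \<epsilon> * heat m (y / l) (-1))"
      and x_l: "x / l \<in> D" if "x \<in> D" for x y
    proof -
      show *: "x / l \<in> D"
        using hom(1)[of "1 / l" x] that l by simp
      show "\<phi> x t + \<epsilon> * heat m y t = l ^ m * (\<phi> (x / l) (-1) + \<epsilon> * heat m (y / l) (-1))"
        using hom(2)[OF l(1) *, of "-1"] heat_homogeneous[of m l "y / l" "-1"] l
        by (simp add: algebra_simps)
    qed
    have lm: "l ^ m > 0"
      using l by simp
    have x: "x \<in> D"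
      using q by simp
    have "\<phi> (x / l) (-1) + \<epsilon> * heat m (y / l) (-1) > 0"
      using q scale[OF x, of y] l by (simp add: zero_less_mult_iff)
    from slice[OF x_l[OF x] this] obtain S x' where S: "connected S" "x / l \<in> S" "x' \<in> S" "S \<subseteq> D"
        "\<And>w. w \<in> S \<Longrightarrow> \<phi> w (-1) + \<epsilon> * heat m (y / l) (-1) > 0" "far x' (y / l) (-1)"
      by blast
    have pos: "\<phi> (l * w) t + \<epsilon> * heat m y' t > 0 \<longleftrightarrow> \<phi> w (-1) + \<epsilon> * heat m (y' / l) (-1) > 0"
      if "w \<in> D" for w y'
      using scale[OF hom(1)[OF l(1) that], of y'] lm l by (simp add: zero_less_mult_iff)
    have "far (l * x') y t"
      unfolding far_def
    proof (intro conjI allI impI)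
      show "l * x' \<in> D"
        using S l hom(1) by blast
      fix y' assume "y \<le> y'"
      then show "\<phi> (l * x') t + \<epsilon> * heat m y' t > 0"
        using S l pos[of x' y'] by (auto simp: far_def divide_right_mono)
    qed
    moreover have "connected_component ?Q (x, y, t) (l * x', y, t)"
    proof (rule connected_componentI)
      show "connected ((\<lambda>w. (l * w, y, t)) ` S)"
        by (intro connected_continuous_image continuous_intros S)
      show "(\<lambda>w. (l * w, y, t)) ` S \<subseteq> ?Q"
        using S pos[of _ y] hom(1) l by auto
      show "(x, y, t) \<in> (\<lambda>w. (l * w, y, t)) ` S"
        using S(2) l by (intro image_eqI[of _ _ "x / l"]) auto
    qed (use S(3) in auto)
    ultimately show ?thesis
      by blast
  qed
  have up: "connected_component ?Q (x, y, t) (x, y', t)" if "far x y t" "y \<le> y'" for x y y' t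
  proof (rule connected_componentI)
    show "connected ((\<lambda>y. (x, y, t)) ` {y..y'})"
      by (intro connected_continuous_image continuous_intros connected_Icc)
  qed (use that in \<open>auto simp: far_def\<close>)
  have far_far: "connected_component ?Q (x1, y1, t1) (x2, y2, t2)"
    if f: "far x1 y1 t1" "far x2 y2 t2" for x1 y1 t1 x2 y2 t2
  proof -
    \<comment> \<open>Both points are lifted to a height where the heat term dominates
      \<open>\<phi>\<close> along the whole segment between their \<open>(x, t)\<close> coordinates;
      convexity of \<open>D\<close> keeps the segment admissible.\<close>
    let ?S = "closed_segment (x1, t1) (x2, t2)"
    have seg: "?S \<subseteq> D \<times> UNIV"
      using f D(2) by (intro closed_segment_subset convex_Times) (auto simp: far_def)
    have "compact ((\<lambda>(x, t). \<phi> x t) ` ?S)" "compact (snd ` ?S)"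
      by (intro compact_continuous_image continuous_on_subset[OF cont seg] continuous_intros compact_segment)+
    then obtain B T where B: "\<And>x t. (x, t) \<in> ?S \<Longrightarrow> \<bar>\<phi> x t\<bar> \<le> B" and T: "\<And>x t. (x, t) \<in> ?S \<Longrightarrow> \<bar>t\<bar> \<le> T"
      by (fastforce dest!: compact_imp_bounded simp: bounded_iff)
    obtain Y where Y: "\<And>y t. y \<ge> Y \<Longrightarrow> \<bar>t\<bar> \<le> T \<Longrightarrow> (B + 1) / \<epsilon> \<le> heat m y t"
      using heat_large[OF m1] by metis
    define Y' where "Y' = max Y (max y1 y2)"
    have "connected_component ?Q (x1, Y', t1) (x2, Y', t2)"
    proof (rule connected_componentI)
      show "connected ((\<lambda>(x, t). (x, Y', t)) ` ?S)"
        unfolding case_prod_unfold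
        by (intro connected_continuous_image continuous_intros connected_segment)
      show "(\<lambda>(x, t). (x, Y', t)) ` ?S \<subseteq> ?Q"
      proof clarify
        fix x t assume xt: "(x, t) \<in> ?S"
        have "(B + 1) / \<epsilon> \<le> heat m Y' t"
          using Y[of Y' t] T[OF xt] by (simp add: Y'_def)
        then have "B + 1 \<le> \<epsilon> * heat m Y' t"
          using \<epsilon> by (simp add: field_simps)
        then show "x \<in> D \<and> 0 < \<phi> x t + \<epsilon> * heat m Y' t"
          using B[OF xt] seg xt by auto
      qed
      show "(x1, Y', t1) \<in> (\<lambda>(x, t). (x, Y', t)) ` ?S" "(x2, Y', t2) \<in> (\<lambda>(x, t). (x, Y', t)) ` ?S"
        by (rule rev_image_eqI[of "(x1, t1)"], simp, simp, rule rev_image_eqI[of "(x2, t2)"], simp, simp)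
    qed
    moreover have "y1 \<le> Y'" "y2 \<le> Y'"
      by (auto simp: Y'_def)
    ultimately show ?thesis
      using up[OF f(1), of Y'] up[OF f(2), of Y', THEN connected_component_sym]
      by (meson connected_component_trans)
  qed
  show ?thesis
    unfolding connected_iff_connected_component
  proof (intro ballI)
    fix a b assume ab: "a \<in> ?Q" "b \<in> ?Q"
    obtain x1 y1 t1 where a: "a = (x1, y1, t1)"
      by (rule prod_cases3)
    obtain x2 y2 t2 where b: "b = (x2, y2, t2)"
      by (rule prod_cases3)
    obtain x1' y1' where 1: "far x1' y1' t1" "connected_component ?Q a (x1', y1', t1)"
      using to_far[OF ab(1)[unfolded a]] unfolding a by blast
    obtain x2' y2' where 2: "far x2' y2' t2" "connected_component ?Q b (x2', y2', t2)"
      using to_far[OF ab(2)[unfolded b]] unfolding b by blast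
    show "connected_component ?Q a b"
      by (rule connected_component_trans[OF 1(2)
          connected_component_trans[OF far_far[OF 1(1) 2(1)] connected_component_sym[OF 2(2)]]])
  qed
qed


text \<open>The constants depend on \<open>\<phi>\<close> only through its absolute value and
  critical points, so one \<open>\<epsilon>\<close> serves both \<open>\<phi>\<close> and
  \<open>- \<phi>\<close>. Since \<open>heat m\<close> is odd in \<open>y\<close>, reflecting
  \<open>y\<close> turns the positive set for \<open>- \<phi>\<close> into the negative set for
  \<open>\<phi>\<close>.\<close>

lemma ex_connected_fibration:
  fixes \<phi> :: "real \<Rightarrow> real \<Rightarrow> real" and D :: "real set"
  assumes D: "open D" "convex D"
    and m: "odd m"
    and cont: "continuous_on (D \<times> UNIV) (\<lambda>(x, t). \<phi> x t)"
    and hom: "\<And>l x. l > 0 \<Longrightarrow> x \<in> D \<Longrightarrow> l * x \<in> D"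
      "\<And>l x t. l > 0 \<Longrightarrow> x \<in> D \<Longrightarrow> \<phi> (l * x) (l\<^sup>2 * t) = l ^ m * \<phi> x t"
    and der: "\<And>x. x \<in> D \<Longrightarrow> ((\<lambda>x. \<phi> x (-1)) has_real_derivative \<phi>' x) (at x)" "continuous_on D \<phi>'"
    and compact: "\<And>c. compact {x \<in> D. \<bar>\<phi> x (-1)\<bar> \<le> c}"
    and simple: "\<And>x. x \<in> D \<Longrightarrow> \<phi> x (-1) = 0 \<Longrightarrow> \<phi>' x \<noteq> 0"
  obtains \<epsilon> where "\<epsilon> > 0"
    "connected {(x, y, t). x \<in> D \<and> \<phi> x t + \<epsilon> * heat m y t > 0}"
    "connected {(x, y, t). x \<in> D \<and> \<phi> x t + \<epsilon> * heat m y t < 0}"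
proof -
  obtain M where M: "M > 0"
    "\<And>c y y'. \<bar>c\<bar> \<ge> M \<Longrightarrow> c < heat m y (-1) \<Longrightarrow> y \<le> y' \<Longrightarrow> c < heat m y' (-1)"
    using heat_odd_superlevel_upward[OF m] by blast
  \<comment> \<open>The critical points in the band of height 1 form a compact set on which
    \<open>\<phi>\<close> does not vanish, so the absolute value of \<open>\<phi>\<close> has a
    positive minimum there; half of it bounds a band free of critical points.\<close>
  obtain \<delta> where \<delta>: "\<delta> > 0" "\<And>x. x \<in> D \<Longrightarrow> \<bar>\<phi> x (-1)\<bar> \<le> \<delta> \<Longrightarrow> \<phi>' x \<noteq> 0"
  proof -
    let ?Q = "{x \<in> D. \<bar>\<phi> x (-1)\<bar> \<le> 1}"
    let ?Z = "?Q \<inter> \<phi>' -` {0}"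
    have "closed ?Z"
      by (intro continuous_closed_preimage continuous_on_subset[OF der(2)] compact_imp_closed compact) auto
    then have "compact ?Z"
      using compact_Int_closed[OF compact[of 1], of ?Z] by (simp only: Int_assoc[symmetric] Int_absorb)
    moreover have "continuous_on ?Z (\<lambda>x. \<bar>\<phi> x (-1)\<bar>)"
      by (intro continuous_on_rabs continuous_at_imp_continuous_on ballI DERIV_isCont[OF der(1)]) simp
    ultimately have *: "\<exists>x\<in>?Z. \<forall>y\<in>?Z. \<bar>\<phi> x (-1)\<bar> \<le> \<bar>\<phi> y (-1)\<bar>" if "?Z \<noteq> {}"
      by (rule continuous_attains_inf[OF _ that])
    show thesis
    proof (cases "?Z = {}")
      case True
      then show ?thesis
        using that[of 1] by auto
    next
      case False
      then obtain x where x: "x \<in> ?Z" "\<And>y. y \<in> ?Z \<Longrightarrow> \<bar>\<phi> x (-1)\<bar> \<le> \<bar>\<phi> y (-1)\<bar>"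
        using *[OF False] by blast
      have "\<phi> x (-1) \<noteq> 0"
        using x(1) simple by blast
      then show ?thesis
        using x by (intro that[of "\<bar>\<phi> x (-1)\<bar> / 2"]) force+
    qed
  qed
  define \<epsilon> where "\<epsilon> = \<delta> / M"
  have pos: "connected {(x, y, t). x \<in> D \<and> \<phi> x t + \<epsilon> * heat m y t > 0}"
    by (rule connected_positive_fibration[where \<phi>' = \<phi>' and \<delta> = \<delta> and M = M];
        fact D m M \<delta> \<epsilon>_def cont hom der compact)
  have cont': "continuous_on (D \<times> UNIV) (\<lambda>(x, t). - \<phi> x t)"
    using cont by (auto simp: case_prod_unfold intro: continuous_on_minus)
  have neg: "connected {(x, y, t). x \<in> D \<and> - \<phi> x t + \<epsilon> * heat m y t > 0}"
  proof (rule connected_positive_fibration[where \<phi>' = "\<lambda>x. - \<phi>' x" and \<delta> = \<delta> and M = M])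
    show "- \<phi> (l * x) (l\<^sup>2 * t) = l ^ m * - \<phi> x t" if "l > 0" "x \<in> D" for l x t
      using hom(2)[OF that] by simp
    show "((\<lambda>x. - \<phi> x (-1)) has_real_derivative - \<phi>' x) (at x)" if "x \<in> D" for x
      using der(1)[OF that] by (rule DERIV_minus)
    show "compact {x \<in> D. \<bar>- \<phi> x (-1)\<bar> \<le> \<delta>}"
      using compact by simp
    show "- \<phi>' x \<noteq> 0" if "x \<in> D" "\<bar>- \<phi> x (-1)\<bar> \<le> \<delta>" for x
      using \<delta>(2) that by simp
  qed (fact D m M \<delta> \<epsilon>_def cont' hom)+
  have "{(x, y, t). x \<in> D \<and> \<phi> x t + \<epsilon> * heat m y t < 0} =
      (\<lambda>(x, y, t). (x, - y, t)) ` {(x, y, t). x \<in> D \<and> - \<phi> x t + \<epsilon> * heat m y t > 0}"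
    (is "?L = ?f ` ?R")
  proof
    show "?L \<subseteq> ?f ` ?R"
    proof
      fix a assume a: "a \<in> ?L"
      obtain x y t where "a = (x, y, t)"
        by (metis prod_cases3)
      with a m show "a \<in> ?f ` ?R"
        by (intro image_eqI[of _ _ "(x, - y, t)"]) (auto simp: heat_odd_minus)
    qed
  qed (use m in \<open>auto simp: heat_odd_minus\<close>)
  also have "connected \<dots>"
    using neg unfolding case_prod_unfold by (intro connected_continuous_image continuous_intros)
  finally show ?thesis
    using that[of \<epsilon>] pos \<delta>(1) M(1) by (simp add: \<epsilon>_def)
qed

section \<open>Caloric polynomials built from heat polynomials\<close>

lemma real_polynomial_function_coords:
  "real_polynomial_function (\<lambda>z :: (real ^ 'n) \<times> real. fst z $ i)"
  "real_polynomial_function (\<lambda>z :: (real ^ 'n) \<times> real. snd z)"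
proof -
  have "bounded_linear (\<lambda>z :: (real ^ 'n) \<times> real. fst z $ i)"
    by (rule bounded_linear_compose[OF bounded_linear_vec_nth bounded_linear_fst])
  then show "real_polynomial_function (\<lambda>z :: (real ^ 'n) \<times> real. fst z $ i)"
    by (rule real_polynomial_function.intros(1))
  show "real_polynomial_function (\<lambda>z :: (real ^ 'n) \<times> real. snd z)"
    by (intro real_polynomial_function.intros(1) bounded_linear_snd)
qed

definition heat_coord :: "nat \<Rightarrow> 'n \<Rightarrow> (real ^ 'n) \<times> real \<Rightarrow> real" where
  "heat_coord n i z = heat n (fst z $ i) (snd z)"

lemma heat_coord_derivative_space:
  "((\<lambda>s. heat_coord n i (z + s *\<^sub>R (axis l 1, 0))) has_real_derivative
    (if l = i then real n * heat_coord (n - 1) i z else 0)) (at 0)"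
proof (cases "l = i")
  case True
  have "((\<lambda>s. heat n (fst z $ i + s) (snd z)) has_real_derivative
      real n * heat (n - 1) (fst z $ i + 0) (snd z)) (at 0)"
    using DERIV_shift[of "\<lambda>x. heat n x (snd z)" "real n * heat (n - 1) (fst z $ i + 0) (snd z)" 0 "fst z $ i"]
      heat_has_derivative_x[of n "snd z" "0 + fst z $ i"]
    by (simp add: add.commute)
  then show ?thesis
    using True by (simp add: heat_coord_def axis_def)
qed (simp add: heat_coord_def axis_def)

lemma heat_coord_derivative_time:
  "((\<lambda>s. heat_coord n i (z + s *\<^sub>R (0, 1))) has_real_derivative
    real n * real (n - 1) * heat_coord (n - 2) i z) (at 0)"
  using DERIV_shift[of "heat n (fst z $ i)" "real n * real (n - 1) * heat (n - 2) (fst z $ i) (0 + snd z)" 0 "snd z"]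
    heat_has_derivative_t[of n "fst z $ i" "0 + snd z"]
  by (simp add: heat_coord_def add.commute)

text \<open>One family covers all examples: \<open>a = 0\<close> reduces the product to a single
  heat polynomial, and \<open>a = 1\<close> gives a coordinate times a heat polynomial. The index
  \<open>k\<close> may coincide with \<open>i\<close> or \<open>j\<close>.\<close>

definition heat_sum :: "nat \<Rightarrow> 'n \<Rightarrow> real \<Rightarrow> nat \<Rightarrow> 'n \<Rightarrow> nat \<Rightarrow> 'n \<Rightarrow> (real ^ 'n) \<times> real \<Rightarrow> real" where
  "heat_sum d k \<epsilon> a i b j z = heat_coord d k z + \<epsilon> * (heat_coord a i z * heat_coord b j z)"

lemma time_deriv_heat_sum:
  "time_deriv (heat_sum d k \<epsilon> a i b j) z = real d * real (d - 1) * heat_coord (d - 2) k z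
    + \<epsilon> * (real a * real (a - 1) * heat_coord (a - 2) i z * heat_coord b j z
      + real b * real (b - 1) * heat_coord (b - 2) j z * heat_coord a i z)"
proof -
  show ?thesis
    unfolding time_deriv_def heat_sum_def[abs_def]
    by (rule partial_along_eqI)
       ((rule derivative_eq_intros heat_coord_derivative_time refl)+, simp flip: zero_prod_def)
qed

text \<open>Because \<open>i \<noteq> j\<close>, no coordinate direction differentiates both factors
  of the product, so the Laplacian has no cross term and each factor contributes its own heat
  equation.\<close>

lemma space_laplacian_heat_sum:
  fixes k :: "'n::finite"
  assumes "i \<noteq> j"
  shows "space_laplacian (heat_sum d k \<epsilon> a i b j) z = time_deriv (heat_sum d k \<epsilon> a i b j) z"
proof -
  let ?e = "\<lambda>l. (axis l 1, 0) :: (real ^ 'n) \<times> real"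
  have 1: "partial_along (?e l) (heat_sum d k \<epsilon> a i b j) = (\<lambda>z.
      (if l = k then real d * heat_coord (d - 1) k z else 0)
      + \<epsilon> * ((if l = i then real a * heat_coord (a - 1) i z else 0) * heat_coord b j z
        + (if l = j then real b * heat_coord (b - 1) j z else 0) * heat_coord a i z))" for l
    unfolding heat_sum_def[abs_def]
    by (rule ext, rule partial_along_eqI) 
       ((rule derivative_eq_intros heat_coord_derivative_space refl)+, simp flip: zero_prod_def)
  have 2: "partial_along (?e l) (partial_along (?e l) (heat_sum d k \<epsilon> a i b j)) z =
      (if l = k then real d * real (d - 1) * heat_coord (d - 2) k z else 0)
      + \<epsilon> * ((if l = i then real a * real (a - 1) * heat_coord (a - 2) i z * heat_coord b j z else 0)
        + (if l = j then real b * real (b - 1) * heat_coord (b - 2) j z * heat_coord a i z else 0))" for l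
    unfolding 1
    using assms
    by (intro partial_along_eqI, cases "l = k"; cases "l = i"; cases "l = j"; simp only: if_True if_False simp_thms)
       ((rule derivative_eq_intros heat_coord_derivative_space refl)+, simp add: numeral_2_eq_2 flip: zero_prod_def)+
  show ?thesis
    unfolding space_laplacian_def 2 time_deriv_heat_sum
    by (simp add: sum.distrib flip: sum_distrib_left)
qed

text \<open>At the point with all coordinates and time equal to 1 every heat polynomial is positive,
  which shows that the sum and, for \<open>d \<ge> 2\<close>, its time derivative do not vanish
  identically.\<close>

lemma heat_sum_hcp:
  fixes k :: "'n::finite"
  assumes ij: "i \<noteq> j" and ab: "a + b = d" and \<epsilon>: "\<epsilon> \<ge> 0"
  shows "hcp d (heat_sum d k \<epsilon> a i b j)"
    and "d \<ge> 2 \<Longrightarrow> time_dependent (heat_sum d k \<epsilon> a i b j)"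
proof -
  let ?z = "(\<chi> _. 1, 1) :: (real ^ 'n) \<times> real"
  have pos: "heat_coord n l ?z > 0" for n l
    by (simp add: heat_coord_def heat_pos)
  show "time_dependent (heat_sum d k \<epsilon> a i b j)" if "d \<ge> 2"
  proof -
    have "time_deriv (heat_sum d k \<epsilon> a i b j) ?z > 0"
      unfolding time_deriv_heat_sum using that \<epsilon>
      by (intro add_pos_nonneg mult_pos_pos mult_nonneg_nonneg add_nonneg_nonneg pos less_imp_le[OF pos]) auto
    then show ?thesis
      unfolding time_dependent_def by (metis less_irrefl)
  qed
  have "heat_sum d k \<epsilon> a i b j ?z > 0"
    unfolding heat_sum_def using \<epsilon>
    by (intro add_pos_nonneg mult_nonneg_nonneg pos less_imp_le[OF pos])
  moreover have "real_polynomial_function (heat_sum d k \<epsilon> a i b j)"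
    unfolding heat_sum_def[abs_def] heat_coord_def[abs_def]
    by (intro real_polynomial_function.intros(2-4) real_polynomial_function_heat real_polynomial_function_coords)
  moreover have "heat_sum d k \<epsilon> a i b j (l *\<^sub>R x, l\<^sup>2 * t) = l ^ d * heat_sum d k \<epsilon> a i b j (x, t)" for l x t
    by (simp add: heat_sum_def heat_coord_def heat_homogeneous flip: ab) (simp add: power_add algebra_simps)
  ultimately show "hcp d (heat_sum d k \<epsilon> a i b j)"
    unfolding hcp_def space_laplacian_heat_sum[OF ij] by (metis cancel_comm_monoid_add_class.diff_cancel less_irrefl)
qed

section \<open>Lifting connectedness from a few coordinates\<close>

text \<open>The map \<open>g\<close> parametrises all fibres of \<open>f\<close> by one connected
  space, so the preimage of \<open>S\<close> is a continuous image of a product of connected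
  sets.\<close>

lemma connected_preimage_section:
  fixes g :: "'a::topological_space \<times> 'w::topological_space \<Rightarrow> 'b::topological_space"
  assumes "continuous_on UNIV g" "\<And>s w. f (g (s, w)) = s" "\<And>z. \<exists>w. g (f z, w) = z"
    and "connected S" and "connected (UNIV :: 'w set)"
  shows "connected (f -` S)"
proof -
  have "f -` S = g ` (S \<times> (UNIV :: 'w set))"
  proof
    show "f -` S \<subseteq> g ` (S \<times> UNIV)"
    proof
      fix z assume "z \<in> f -` S"
      moreover obtain w where "g (f z, w) = z"
        using assms(3) by blast
      ultimately show "z \<in> g ` (S \<times> UNIV)"
        by (intro image_eqI[of _ _ "(f z, w)"]) auto
    qed
  qed (use assms(2) in auto)
  then show ?thesis
    using assms by (simp add: connected_continuous_image[OF continuous_on_subset] connected_Times)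
qed

lemma connected_two_coords:
  fixes i j :: "'n::finite"
  assumes "connected {(x, y, t). R x y t}" "i \<noteq> j"
  shows "connected {z :: (real ^ 'n) \<times> real. R (fst z $ i) (fst z $ j) (snd z)}"
proof -
  let ?f = "\<lambda>z :: (real ^ 'n) \<times> real. (fst z $ i, fst z $ j, snd z)"
  \<comment> \<open>The auxiliary vector supplies the remaining coordinates; its entries at
    \<open>i\<close> and \<open>j\<close> are overwritten.\<close>
  let ?g = "\<lambda>sw :: (real \<times> real \<times> real) \<times> (real ^ 'n).
    ((\<chi> l. if l = i then fst (fst sw) else if l = j then fst (snd (fst sw)) else snd sw $ l), snd (snd (fst sw)))"
  have "connected (?f -` {(x, y, t). R x y t})"
  proof (rule connected_preimage_section[of ?g ?f, OF _ _ _ assms(1) connected_UNIV])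
    have "continuous_on UNIV (\<lambda>sw :: (real \<times> real \<times> real) \<times> (real ^ 'n). if l = i then fst (fst sw) else if l = j then fst (snd (fst sw)) else snd sw $ l)" for l
      by (cases "l = i"; cases "l = j") (auto intro!: continuous_intros)
    then show "continuous_on UNIV ?g"
      by (intro continuous_on_Pair continuous_on_vec_lambda continuous_intros)
    show "\<exists>w. ?g (?f z, w) = z" for z
      by (rule exI[of _ "fst z"]) (auto simp: vec_eq_iff prod_eq_iff)
  qed (use assms(2) in auto)
  then show ?thesis
    by (simp add: vimage_def)
qed

lemma connected_three_coords:
  fixes i j k :: "'n::finite"
  assumes "connected {(x, y, v, t). R x y v t}" "i \<noteq> j" "i \<noteq> k" "j \<noteq> k"
  shows "connected {z :: (real ^ 'n) \<times> real. R (fst z $ i) (fst z $ j) (fst z $ k) (snd z)}"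
proof -
  let ?f = "\<lambda>z :: (real ^ 'n) \<times> real. (fst z $ i, fst z $ j, fst z $ k, snd z)"
  let ?g = "\<lambda>sw :: (real \<times> real \<times> real \<times> real) \<times> (real ^ 'n).
    ((\<chi> l. if l = i then fst (fst sw) else if l = j then fst (snd (fst sw)) else
      if l = k then fst (snd (snd (fst sw))) else snd sw $ l), snd (snd (snd (fst sw))))"
  have "connected (?f -` {(x, y, v, t). R x y v t})"
  proof (rule connected_preimage_section[of ?g ?f, OF _ _ _ assms(1) connected_UNIV])
    have "continuous_on UNIV (\<lambda>sw :: (real \<times> real \<times> real \<times> real) \<times> (real ^ 'n). if l = i then fst (fst sw) else if l = j then fst (snd (fst sw)) else
      if l = k then fst (snd (snd (fst sw))) else snd sw $ l)" for l
      by (cases "l = i"; cases "l = j"; cases "l = k") (auto intro!: continuous_intros)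
    then show "continuous_on UNIV ?g"
      by (intro continuous_on_Pair continuous_on_vec_lambda continuous_intros)
    show "\<exists>w. ?g (?f z, w) = z" for z
      by (rule exI[of _ "fst z"]) (auto simp: vec_eq_iff prod_eq_iff)
  qed (use assms(2-) in auto)
  then show ?thesis
    by (simp add: vimage_def)
qed

section \<open>Examples and conclusion\<close>

text \<open>The fibration result applies on the whole line with \<open>\<phi> = heat d\<close>:
  growth at both ends makes the bands compact, and the zeros at time -1 are simple.\<close>

lemma heat_odd_sum_connected:
  assumes d: "odd d"
  obtains \<epsilon> where "\<epsilon> > 0" "connected {(x, y, t). heat d x t + \<epsilon> * heat d y t > 0}"
    "connected {(x, y, t). heat d x t + \<epsilon> * heat d y t < 0}"
proof -
  have d1: "d \<ge> 1"
    using d by (cases d) auto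
  show thesis
  proof (rule ex_connected_fibration[of UNIV d "heat d" "\<lambda>x. real d * heat (d - 1) x (-1)"])
    show "continuous_on (UNIV \<times> UNIV) (\<lambda>(x, t). heat d x t)"
      unfolding case_prod_unfold by (intro continuous_intros)
    show "compact {x \<in> UNIV. \<bar>heat d x (-1)\<bar> \<le> c}" for c
    proof -
      obtain Y where Y: "Y \<ge> 1" "\<And>y t. y \<ge> Y \<Longrightarrow> \<bar>t\<bar> \<le> 1 \<Longrightarrow> c + 1 \<le> heat d y t"
        using heat_large[OF d1] by metis
      have "\<bar>x\<bar> \<le> Y" if "\<bar>heat d x (-1)\<bar> \<le> c" for x
        using Y(2)[of x "-1"] Y(2)[of "- x" "-1"] that d by (force simp: heat_odd_minus abs_le_iff)
      then have "bounded {x. \<bar>heat d x (-1)\<bar> \<le> c}"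
        unfolding bounded_iff by auto
      moreover have "closed {x. \<bar>heat d x (-1)\<bar> \<le> c}"
        by (intro closed_Collect_le continuous_intros)
      ultimately show ?thesis
        by (simp add: compact_eq_bounded_closed)
    qed
    show "real d * heat (d - 1) x (-1) \<noteq> 0" if "heat d x (-1) = 0" for x
      using heat_simple_zero[of "d - 1" x "-1"] that d1 by simp
  qed (use d that in \<open>auto simp: heat_homogeneous heat_has_derivative_x[simplified] intro!: continuous_intros\<close>)
qed

lemma heat_even_at_0_minus1: "even d \<Longrightarrow> heat d 0 (-1) \<noteq> 0"
  using heat_even_at_0[of "d div 2" "-1"] heat_even_at_0_t1[of d] by auto

text \<open>Dividing by \<open>x > 0\<close> leaves a fibration whose base function
  \<open>heat d x t / x\<close> has odd degree \<open>d - 1\<close>. At time -1 it is unbounded both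
  near \<open>x = 0\<close> and at infinity, so its bands are compact in the open half line.\<close>

lemma heat_even_quotient_connected:
  assumes d: "even d" "d \<ge> 2"
  obtains \<epsilon> where "\<epsilon> > 0"
    "connected {(x, y, t). x > 0 \<and> heat d x t + \<epsilon> * (x * heat (d - 1) y t) > 0}"
    "connected {(x, y, t). x > 0 \<and> heat d x t + \<epsilon> * (x * heat (d - 1) y t) < 0}"
proof -
  let ?\<phi> = "\<lambda>x t. heat d x t / x"
  let ?\<phi>' = "\<lambda>x. (real d * heat (d - 1) x (-1) * x - heat d x (-1)) / (x * x)"
  have odd: "odd (d - 1)"
    using d by auto
  obtain \<epsilon> where \<epsilon>: "\<epsilon> > 0"
    "connected {(x, y, t). x \<in> {0<..} \<and> ?\<phi> x t + \<epsilon> * heat (d - 1) y t > 0}"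
    "connected {(x, y, t). x \<in> {0<..} \<and> ?\<phi> x t + \<epsilon> * heat (d - 1) y t < 0}"
  proof (rule ex_connected_fibration[of "{0<..}" "d - 1" ?\<phi> ?\<phi>'])
    show "odd (d - 1)" by fact
    show "continuous_on ({0<..} \<times> UNIV) (\<lambda>(x, t). heat d x t / x)"
      unfolding case_prod_unfold by (intro continuous_intros) auto
    show "heat d (l * x) (l\<^sup>2 * t) / (l * x) = l ^ (d - 1) * (heat d x t / x)" if "l > 0" for l x t
      using that d by (simp add: heat_homogeneous power_eq_if[of l d])
    show "((\<lambda>x. heat d x (-1) / x) has_real_derivative ?\<phi>' x) (at x)" if "x \<in> {0<..}" for x
      using that by (auto intro!: derivative_eq_intros heat_has_derivative_x)
    show "continuous_on {0<..} ?\<phi>'"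
      by (intro continuous_intros) auto
    show "?\<phi>' x \<noteq> 0" if "x \<in> {0<..}" "heat d x (-1) / x = 0" for x
      using heat_simple_zero[of "d - 1" x "-1"] that d by simp
    show "compact {x \<in> {0<..}. \<bar>heat d x (-1) / x\<bar> \<le> c}" for c
    proof -
      obtain Y where Y: "Y \<ge> 1" "\<And>y t. y \<ge> Y \<Longrightarrow> \<bar>t\<bar> \<le> 1 \<Longrightarrow> y ^ d / 2 \<le> heat d y t"
        by (rule heat_lower_bound[of 1 d]) blast
      \<comment> \<open>After multiplication by \<open>x\<close> the condition is closed on
        \<open>{0..}\<close>; it excludes \<open>x = 0\<close> by itself because
        \<open>heat d 0 (-1)\<close> is nonzero.\<close>
      have eq: "{x \<in> {0<..}. \<bar>heat d x (-1) / x\<bar> \<le> c} = {0..} \<inter> {x. \<bar>heat d x (-1)\<bar> \<le> c * x}"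
        using heat_even_at_0_minus1[OF d(1)] by (auto simp: abs_divide field_simps order_le_less)
      have "\<bar>x\<bar> \<le> max Y (2 * c)" if x: "x > 0" "\<bar>heat d x (-1) / x\<bar> \<le> c" for x
      proof (rule ccontr)
        assume "\<not> ?thesis"
        then have x': "x > Y" "x > 2 * c"
          using x by auto
        have "x * x \<le> x ^ d"
          using power_increasing[OF d(2), of x] x' Y(1) by (simp add: power2_eq_square)
        then have "x * x / 2 \<le> heat d x (-1)"
          using Y(2)[of x "-1"] x' by simp
        then have "x / 2 \<le> heat d x (-1) / x"
          using x by (simp add: field_simps)
        then show False
          using x(2) x'(2) abs_ge_self[of "heat d x (-1) / x"] by linarith
      qed
      then have "bounded {x \<in> {0<..}. \<bar>heat d x (-1) / x\<bar> \<le> c}"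
        by (intro boundedI[of _ "max Y (2 * c)"]) (simp only: mem_Collect_eq greaterThan_iff real_norm_def)
      moreover have "closed ({0..} \<inter> {x. \<bar>heat d x (-1)\<bar> \<le> c * x})"
        by (intro closed_Int closed_atLeast closed_Collect_le continuous_intros)
      ultimately show ?thesis
        unfolding eq by (simp add: compact_eq_bounded_closed)
    qed
  qed auto
  have "heat d x t + \<epsilon> * (x * heat (d - 1) y t) = x * (?\<phi> x t + \<epsilon> * heat (d - 1) y t)" if "x > 0" for x y t
    using that by (simp add: field_simps)
  then have "{(x, y, t). x > 0 \<and> heat d x t + \<epsilon> * (x * heat (d - 1) y t) > 0} =
      {(x, y, t). x \<in> {0<..} \<and> ?\<phi> x t + \<epsilon> * heat (d - 1) y t > 0}"
    "{(x, y, t). x > 0 \<and> heat d x t + \<epsilon> * (x * heat (d - 1) y t) < 0} =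
      {(x, y, t). x \<in> {0<..} \<and> ?\<phi> x t + \<epsilon> * heat (d - 1) y t < 0}"
    by (auto simp: zero_less_mult_iff mult_less_0_iff)
  then show ?thesis
    using that[of \<epsilon>] \<epsilon> by simp
qed

text \<open>Positivity is an open condition, so a boundary point is approached by moving
  \<open>x\<close> slightly to the right, and the larger set lies between a connected set and its
  closure.\<close>

lemma connected_add_boundary:
  fixes P :: "real \<times> real \<times> real \<Rightarrow> real"
  assumes cont: "continuous_on UNIV P" and conn: "connected {(x, y, t). x > 0 \<and> P (x, y, t) > 0}"
  shows "connected {(x, y, t). x \<ge> 0 \<and> P (x, y, t) > 0}"
proof (rule connected_intermediate_closure[OF conn])
  show "{(x, y, t). x \<ge> 0 \<and> P (x, y, t) > 0} \<subseteq> closure {(x, y, t). x > 0 \<and> P (x, y, t) > 0}" (is "?L \<subseteq> closure ?R")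
  proof clarify
    fix x y t :: real assume x: "0 \<le> x" and P: "0 < P (x, y, t)"
    show "(x, y, t) \<in> closure ?R"
      unfolding closure_approachable
    proof (intro allI impI)
      fix e :: real assume e: "e > 0"
      have "open {s. 0 < P (s, y, t)}"
        by (intro open_Collect_less continuous_intros continuous_on_compose2[OF cont]) auto
      then obtain r where r: "r > 0" "ball x r \<subseteq> {s. 0 < P (s, y, t)}"
        using P open_contains_ball by blast
      define h where "h = min r e / 2"
      have h: "0 < h" "h < r" "h < e"
        using r e by (auto simp: h_def min_def)
      then have "x + h \<in> ball x r"
        by (simp add: dist_real_def)
      then have "P (x + h, y, t) > 0"
        using r(2) by blast
      then show "\<exists>a\<in>?R. dist a (x, y, t) < e"
        using h x by (intro bexI[of _ "(x + h, y, t)"]) (auto simp: dist_Pair_Pair dist_real_def)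
    qed
  qed
qed auto

lemma connected_flip:
  fixes S :: "(real \<times> real \<times> real) set"
  assumes "connected S"
  shows "connected ((\<lambda>(x, y, t). (- x, - y, t)) ` S)"
  unfolding case_prod_unfold by (intro connected_continuous_image continuous_intros assms)

text \<open>The symmetry \<open>(x, y) \<mapsto> (- x, - y)\<close> transfers connectedness from one
  closed half to the other. The halves meet on \<open>x = 0\<close> in the sign of
  \<open>heat d 0 t\<close>: positive at time 1, and negative at time -1 exactly when
  \<open>d div 2\<close> is odd.\<close>

lemma heat_even_sum_connected:
  assumes d: "even d" "d \<ge> 2"
  obtains \<epsilon> where "\<epsilon> > 0"
    "connected {(x, y, t). heat d x t + \<epsilon> * (x * heat (d - 1) y t) > 0}"
    "connected {(x, y, t). x \<ge> 0 \<and> heat d x t + \<epsilon> * (x * heat (d - 1) y t) < 0}"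
    "connected {(x, y, t). x \<le> 0 \<and> heat d x t + \<epsilon> * (x * heat (d - 1) y t) < 0}"
    "\<not> 4 dvd d \<Longrightarrow> connected {(x, y, t). heat d x t + \<epsilon> * (x * heat (d - 1) y t) < 0}"
proof -
  obtain \<epsilon> where \<epsilon>: "\<epsilon> > 0"
    "connected {(x, y, t). x > 0 \<and> heat d x t + \<epsilon> * (x * heat (d - 1) y t) > 0}"
    "connected {(x, y, t). x > 0 \<and> heat d x t + \<epsilon> * (x * heat (d - 1) y t) < 0}"
    using heat_even_quotient_connected[OF d] by blast
  define P where "P = (\<lambda>(x, y, t). heat d x t + \<epsilon> * (x * heat (d - 1) y t))"
  have cont: "continuous_on UNIV P" "continuous_on UNIV (\<lambda>z. - P z)"
    unfolding P_def case_prod_unfold by (intro continuous_intros)+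
  have odd: "odd (d - 1)"
    using d by auto
  have flip: "P (- x, - y, t) = P (x, y, t)" for x y t
    using d odd by (simp add: P_def heat_even_minus heat_odd_minus)
  have R: "connected {(x, y, t). x > 0 \<and> P (x, y, t) > 0}" "connected {(x, y, t). x > 0 \<and> P (x, y, t) < 0}"
    using \<epsilon> by (simp_all add: P_def)
  have A: "connected {(x, y, t). x \<ge> 0 \<and> P (x, y, t) > 0}" "connected {(x, y, t). x \<ge> 0 \<and> P (x, y, t) < 0}"
    using connected_add_boundary[OF cont(1)] connected_add_boundary[OF cont(2)] R
    by (simp_all only: neg_0_less_iff_less)
  have flip_set: "(\<lambda>(x, y, t). (- x, - y, t)) ` {(x, y, t). x \<ge> 0 \<and> R (P (x, y, t))} = {(x, y, t). x \<le> 0 \<and> R (P (x, y, t))}"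
    (is "?f ` ?L = ?R") for R
  proof
    show "?R \<subseteq> ?f ` ?L"
    proof clarify
      fix x y t :: real assume "x \<le> 0" "R (P (x, y, t))"
      then show "(x, y, t) \<in> ?f ` ?L"
        using flip[of x y t] by (intro image_eqI[of _ _ "(- x, - y, t)"]) auto
    qed
  qed (auto simp: flip)
  have B: "connected {(x, y, t). x \<le> 0 \<and> P (x, y, t) > 0}" "connected {(x, y, t). x \<le> 0 \<and> P (x, y, t) < 0}"
    using connected_flip[OF A(1)] connected_flip[OF A(2)]
    unfolding flip_set[of "\<lambda>u. u > 0"] flip_set[of "\<lambda>u. u < 0"] by auto
  have Un: "{(x, y, t). x \<ge> 0 \<and> R (P (x, y, t))} \<union> {(x, y, t). x \<le> 0 \<and> R (P (x, y, t))} = {(x, y, t). R (P (x, y, t))}" for R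
    by auto
  have pos: "connected {(x, y, t). P (x, y, t) > 0}"
    unfolding Un[of "\<lambda>u. u > 0", symmetric]
  proof (rule connected_Un[OF A(1) B(1)])
    have "(0, 0, 1) \<in> {(x, y, t). 0 \<le> x \<and> 0 < P (x, y, t)} \<inter> {(x, y, t). x \<le> 0 \<and> 0 < P (x, y, t)}"
      using heat_even_at_0_t1[OF d(1)] by (simp add: P_def)
    then show "{(x, y, t). 0 \<le> x \<and> 0 < P (x, y, t)} \<inter> {(x, y, t). x \<le> 0 \<and> 0 < P (x, y, t)} \<noteq> {}"
      by blast
  qed
  have neg: "connected {(x, y, t). P (x, y, t) < 0}" if "\<not> 4 dvd d"
    unfolding Un[of "\<lambda>u. u < 0", symmetric]
  proof (rule connected_Un[OF A(2) B(2)])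
    have "odd (d div 2)"
      using that d by presburger
    then have "heat d 0 (-1) < 0"
      using heat_even_at_0[of "d div 2" "-1"] heat_even_at_0_t1[OF d(1)] d by simp
    then have "(0, 0, -1) \<in> {(x, y, t). 0 \<le> x \<and> P (x, y, t) < 0} \<inter> {(x, y, t). x \<le> 0 \<and> P (x, y, t) < 0}"
      by (simp add: P_def)
    then show "{(x, y, t). 0 \<le> x \<and> P (x, y, t) < 0} \<inter> {(x, y, t). x \<le> 0 \<and> P (x, y, t) < 0} \<noteq> {}"
      by blast
  qed
  show ?thesis
    using that[OF \<epsilon>(1)] pos A(2) B(2) neg by (simp add: P_def)
qed


section \<open>An example with three space variables\<close>

text \<open>\<open>x s + h v\<close> keeps its sign when \<open>x s\<close> grows, and once \<open>x s\<close> is large \<open>v\<close> can be moved freely.\<close>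

lemma linear_fibre_connected_component:
  fixes h :: "real \<Rightarrow> real"
  assumes s: "s \<noteq> 0" and h: "continuous_on UNIV h" and pos: "x * s + h v > 0" "h v1 > 0"
  shows "connected_component {(x, v). x * s + h v > 0} (x, v) (0, v1)" (is "connected_component ?Q _ _")
proof -
  have "compact (h ` closed_segment v v1)"
    by (intro compact_continuous_image continuous_on_subset[OF h] compact_segment) auto
  then obtain B where "\<forall>z \<in> h ` closed_segment v v1. norm z \<le> B"
    by (meson compact_imp_bounded bounded_iff)
  then have B: "\<bar>h w\<bar> \<le> B" if "w \<in> closed_segment v v1" for w
    using that by simp
  \<comment> \<open>This length makes \<open>X * s\<close> at least
    \<open>\<bar>B\<bar> + 1\<close>, which outweighs \<open>h\<close> on the segment. The path then
    moves \<open>x\<close> to \<open>X\<close>, \<open>v\<close> to \<open>v1\<close>, and finally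
    \<open>x\<close> to 0.\<close>
  define r where "r = (\<bar>x * s\<bar> + \<bar>B\<bar> + 1) / s\<^sup>2"
  have r: "r \<ge> 0" "s\<^sup>2 * r = \<bar>x * s\<bar> + \<bar>B\<bar> + 1"
    using s by (auto simp: r_def)
  define X where "X = x + s * r"
  have Xs: "X * s \<ge> \<bar>B\<bar> + 1"
    using r(2) by (simp add: X_def power2_eq_square algebra_simps abs_if split: if_splits)
  have "connected_component ?Q (x, v) (X, v)"
  proof (rule connected_componentI)
    show "connected ((\<lambda>r. (x + s * r, v)) ` {0..r})"
      by (intro connected_continuous_image continuous_intros connected_Icc)
    show "(\<lambda>r. (x + s * r, v)) ` {0..r} \<subseteq> ?Q"
    proof clarsimp
      fix r' :: real assume "0 \<le> r'"
      then have "0 \<le> s * r' * s"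
        by (metis mult.commute mult.left_commute mult_nonneg_nonneg zero_le_square)
      then show "0 < (x + s * r') * s + h v"
        using pos(1) by (simp add: algebra_simps)
    qed
    show "(x, v) \<in> (\<lambda>r. (x + s * r, v)) ` {0..r}"
      using r(1) by (intro image_eqI[of _ _ 0]) auto
    show "(X, v) \<in> (\<lambda>r. (x + s * r, v)) ` {0..r}"
      using r(1) by (auto simp: X_def)
  qed
  moreover have "connected_component ?Q (X, v) (X, v1)"
  proof (rule connected_componentI)
    show "connected ((\<lambda>w. (X, w)) ` closed_segment v v1)"
      by (intro connected_continuous_image continuous_intros connected_segment)
    show "(\<lambda>w. (X, w)) ` closed_segment v v1 \<subseteq> ?Q"
      using Xs B by (fastforce simp: abs_le_iff)
  qed auto
  moreover have "connected_component ?Q (X, v1) (0, v1)"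
  proof (rule connected_componentI)
    show "connected ((\<lambda>u. (X * u, v1)) ` {0..1})"
      by (intro connected_continuous_image continuous_intros connected_Icc)
    show "(\<lambda>u. (X * u, v1)) ` {0..1} \<subseteq> ?Q"
    proof clarsimp
      fix u :: real assume "0 \<le> u"
      then have "0 \<le> X * s * u"
        using Xs by (intro mult_nonneg_nonneg[of "X * s"]) auto
      then show "0 < X * u * s + h v1"
        using pos(2) by (simp add: algebra_simps)
    qed
    show "(X, v1) \<in> (\<lambda>u. (X * u, v1)) ` {0..1}"
      by (intro image_eqI[of _ _ 1]) auto
    show "(0, v1) \<in> (\<lambda>u. (X * u, v1)) ` {0..1}"
      by (intro image_eqI[of _ _ 0]) auto
  qed
  ultimately show ?thesis
    by (meson connected_component_trans)
qed

text \<open>At fixed time, a nonzero \<open>heat (d - 1) y t\<close> allows the linear fibre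
  argument. If it vanishes, the sign comes from \<open>heat d v t\<close> alone, so \<open>x\<close>
  can be set to 0 and \<open>y\<close> moved to a value where it does not vanish. The factor
  \<open>\<sigma>\<close> handles both signs at once.\<close>

lemma linear_heat_connected_component:
  fixes \<sigma> :: real
  assumes d: "d \<ge> 2" and pos: "\<sigma> * (x * heat (d - 1) y t + heat d v t) > 0" "\<sigma> * heat d v1 t > 0"
  shows "connected_component {(x, y, v, t). \<sigma> * (x * heat (d - 1) y t + heat d v t) > 0} (x, y, v, t) (0, 0, v1, t)"
    (is "connected_component ?Q _ _")
proof -
  have \<sigma>: "\<sigma> \<noteq> 0"
    using pos by auto
  have main: "connected_component ?Q (x, y, v, t) (0, y, v1, t)"
    if y: "heat (d - 1) y t \<noteq> 0" and pos': "\<sigma> * (x * heat (d - 1) y t + heat d v t) > 0" for x y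
  proof -
    have "connected_component {(x, v). x * (\<sigma> * heat (d - 1) y t) + \<sigma> * heat d v t > 0} (x, v) (0, v1)"
      using y \<sigma> pos' pos(2)
      by (intro linear_fibre_connected_component continuous_intros) (auto simp: algebra_simps)
    then obtain T where T: "connected T" "(x, v) \<in> T" "(0, v1) \<in> T"
      "T \<subseteq> {(x, v). x * (\<sigma> * heat (d - 1) y t) + \<sigma> * heat d v t > 0}"
      unfolding connected_component_def by blast
    show ?thesis
    proof (rule connected_componentI)
      show "connected ((\<lambda>xv. (fst xv, y, snd xv, t)) ` T)"
        by (intro connected_continuous_image continuous_intros T)
      show "(\<lambda>xv. (fst xv, y, snd xv, t)) ` T \<subseteq> ?Q"
        using T(4) by (auto simp: algebra_simps)
      show "(x, y, v, t) \<in> (\<lambda>xv. (fst xv, y, snd xv, t)) ` T" "(0, y, v1, t) \<in> (\<lambda>xv. (fst xv, y, snd xv, t)) ` T"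
        using T(2,3) by force+
    qed
  qed
  have move_y: "connected_component ?Q (0, y, v, t) (0, y', v, t)" if "\<sigma> * heat d v t > 0" for y y' v
  proof (rule connected_componentI)
    show "connected ((\<lambda>y. (0 :: real, y :: real, v, t)) ` UNIV)"
      by (intro connected_continuous_image continuous_intros connected_UNIV)
  qed (use that in auto)
  show ?thesis
  proof (cases "heat (d - 1) y t = 0")
    case False
    then show ?thesis
      using main[OF False pos(1)] move_y[OF pos(2), of y 0] by (meson connected_component_trans)
  next
    case True
    obtain Y where Y: "1 \<le> heat (d - 1) Y t"
    proof (rule heat_large[of "d - 1" "\<bar>t\<bar>" 1])
      fix Y assume "1 \<le> Y" "\<And>y t'. Y \<le> y \<Longrightarrow> \<bar>t'\<bar> \<le> \<bar>t\<bar> \<Longrightarrow> 1 \<le> heat (d - 1) y t'"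
      then show thesis
        using that[of Y] by simp
    qed (use d in auto)
    have v: "\<sigma> * heat d v t > 0"
      using pos(1) True by simp
    have "connected_component ?Q (x, y, v, t) (0, y, v, t)"
    proof (rule connected_componentI)
      show "connected ((\<lambda>x. (x :: real, y, v, t)) ` UNIV)"
        by (intro connected_continuous_image continuous_intros connected_UNIV)
    qed (use v True in auto)
    moreover note move_y[OF v, of y Y]
    moreover have "connected_component ?Q (0, Y, v, t) (0, Y, v1, t)"
      using main[of Y 0] Y v by simp
    moreover note move_y[OF pos(2), of Y 0]
    ultimately show ?thesis
      by (meson connected_component_trans)
  qed
qed

text \<open>For large \<open>V\<close>, \<open>heat d V\<close> is positive at all times between the
  two given ones, so the points \<open>(0, 0, V, t)\<close> form a bridge between time
  slices.\<close>

lemma linear_heat_positive_connected: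
  assumes d: "d \<ge> 2"
  shows "connected {(x, y, v, t). x * heat (d - 1) y t + heat d v t > 0}" (is "connected ?Q")
  unfolding connected_iff_connected_component
proof (intro ballI)
  fix a b assume ab: "a \<in> ?Q" "b \<in> ?Q"
  obtain x y v t where a: "a = (x, y, v, t)"
    by (rule prod_cases4)
  obtain x' y' v' t' where b: "b = (x', y', v', t')"
    by (rule prod_cases4)
  obtain V where V: "\<And>v t''. v \<ge> V \<Longrightarrow> \<bar>t''\<bar> \<le> max \<bar>t\<bar> \<bar>t'\<bar> \<Longrightarrow> 1 \<le> heat d v t''"
    using heat_large[of d "max \<bar>t\<bar> \<bar>t'\<bar>" 1] d by (metis one_le_numeral order_trans)
  have "connected_component ?Q a (0, 0, V, t)"
    using linear_heat_connected_component[OF d, of 1 x y t v V] ab(1) V[of V t] by (simp add: a)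
  moreover have "connected_component ?Q b (0, 0, V, t')"
    using linear_heat_connected_component[OF d, of 1 x' y' t' v' V] ab(2) V[of V t'] by (simp add: b)
  moreover have "connected_component ?Q (0, 0, V, t) (0, 0, V, t')"
  proof (rule connected_componentI)
    show "connected ((\<lambda>t. (0 :: real, 0 :: real, V, t)) ` closed_segment t t')"
      by (intro connected_continuous_image continuous_intros connected_segment)
    show "(\<lambda>t. (0, 0, V, t)) ` closed_segment t t' \<subseteq> ?Q"
    proof clarsimp
      fix s assume "s \<in> closed_segment t t'"
      then have "\<bar>s\<bar> \<le> max \<bar>t\<bar> \<bar>t'\<bar>"
        by (auto simp: closed_segment_eq_real_ivl split: if_splits)
      then show "0 < heat d V s"
        using V[of V s] by simp
    qed
  qed auto
  ultimately show "connected_component ?Q a b"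
    by (meson connected_component_sym connected_component_trans)
qed

text \<open>At negative times the parabola through \<open>(v0, -1)\<close> supplies base points. At
  times \<open>t \<ge> 0\<close> there are none, since \<open>heat d v t \<ge> 0\<close>; such a
  point is first carried to time -1 with the product term made strongly negative.\<close>

lemma linear_heat_negative_connected:
  assumes d: "d \<ge> 2" "even d" and v0: "heat d v0 (-1) < 0"
  shows "connected {(x, y, v, t). x * heat (d - 1) y t + heat d v t < 0}" (is "connected ?Q")
proof -
  have odd: "odd (d - 1)" "d - 1 \<ge> 1"
    using d by auto
  define w where "w t = (0 :: real, 0 :: real, v0 * sqrt (- t), t)" for t
  have heat_w: "heat d (v0 * sqrt (- t)) t < 0" if "t < 0" for t
    using heat_homogeneous[of d "sqrt (- t)" v0 "-1"] that v0
    by (simp add: mult.commute[of v0] mult_pos_neg)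
  have past: "connected_component ?Q (x, y, v, t) (w t)" if "(x, y, v, t) \<in> ?Q" "t < 0" for x y v t
  proof -
    have eq: "{(x, y, v, t). 0 < -1 * (x * heat (d - 1) y t + heat d v t)} = ?Q"
      unfolding mult_minus1 neg_0_less_iff_less ..
    show ?thesis
      using linear_heat_connected_component[OF d(1), of "-1" x y t v "v0 * sqrt (- t)"] that heat_w[OF that(2)]
      unfolding eq w_def by simp
  qed
  have future: "connected_component ?Q (x, y, v, t) (w (-1))" if q: "(x, y, v, t) \<in> ?Q" and t: "t \<ge> 0" for x y v t
  proof -
    \<comment> \<open>The set is invariant under \<open>(x, y) \<mapsto> (- x, - y)\<close>; the
      sign \<open>\<rho>\<close> reduces to \<open>\<xi> \<le> 0\<close>, where negativity forces
      \<open>heat (d - 1) \<eta> t > 0\<close>.\<close>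
    define \<rho> :: real where "\<rho> = (if x < 0 then 1 else -1)"
    define \<xi> where "\<xi> = \<rho> * x"
    define \<eta> where "\<eta> = \<rho> * y"
    have \<rho>: "\<rho> * \<rho> = 1" "heat (d - 1) (\<rho> * u) s = \<rho> * heat (d - 1) u s" for u s
      using odd by (auto simp: \<rho>_def heat_odd_minus)
    have xy: "x = \<rho> * \<xi>" "y = \<rho> * \<eta>"
      using \<rho>(1) by (simp_all add: \<xi>_def \<eta>_def flip: mult.assoc)
    have Q_iff: "(\<rho> * x', \<rho> * y', v', t') \<in> ?Q \<longleftrightarrow> x' * heat (d - 1) y' t' + heat d v' t' < 0" for x' y' v' t'
    proof -
      have "\<rho> * x' * (\<rho> * heat (d - 1) y' t') = (\<rho> * \<rho>) * (x' * heat (d - 1) y' t')"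
        by (simp only: ac_simps)
      then show ?thesis
        by (simp only: mem_Collect_eq case_prod_conv \<rho> mult_1)
    qed
    have neg: "\<xi> * heat (d - 1) \<eta> t + heat d v t < 0"
      using q Q_iff[of \<xi> \<eta> v t] unfolding xy[symmetric] by simp
    have "heat d v t \<ge> 0"
      using heat_even_nonneg[OF d(2) t] .
    then have "\<xi> * heat (d - 1) \<eta> t < 0"
      using neg by linarith
    moreover have "\<xi> \<le> 0"
      by (simp add: \<xi>_def \<rho>_def)
    ultimately have \<xi>: "\<xi> < 0" "heat (d - 1) \<eta> t > 0"
      by (auto simp: mult_less_0_iff)
    obtain Y where Y: "\<And>y s. y \<ge> Y \<Longrightarrow> \<bar>s\<bar> \<le> t + 1 \<Longrightarrow> 1 \<le> heat (d - 1) y s"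
      using heat_large[OF odd(2), of "t + 1" 1] by metis
    define Y' where "Y' = max Y \<eta>"
    have "compact ((\<lambda>s. heat d v s) ` {-1..t})"
      by (intro compact_continuous_image continuous_intros compact_Icc)
    then obtain B where "\<forall>z \<in> (\<lambda>s. heat d v s) ` {-1..t}. norm z \<le> B"
      by (meson compact_imp_bounded bounded_iff)
    then have B: "\<bar>heat d v s\<bar> \<le> B" if "s \<in> {-1..t}" for s
      using that by simp
    \<comment> \<open>With \<open>heat (d - 1) Y' s \<ge> 1\<close>, this makes the product at most
      \<open>- B - 1\<close>, below anything \<open>heat d v\<close> can compensate on
      \<open>{-1..t}\<close>.\<close>
    define X where "X = min \<xi> (- B - 1)"
    have "connected_component ?Q (\<rho> * \<xi>, \<rho> * \<eta>, v, t) (\<rho> * \<xi>, \<rho> * Y', v, t)"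
    proof (rule connected_componentI)
      show "connected ((\<lambda>y. (\<rho> * \<xi>, \<rho> * y, v, t)) ` {\<eta>..Y'})"
        by (intro connected_continuous_image continuous_intros connected_Icc)
      show "(\<lambda>y. (\<rho> * \<xi>, \<rho> * y, v, t)) ` {\<eta>..Y'} \<subseteq> ?Q"
      proof (intro image_subsetI)
        fix y assume "y \<in> {\<eta>..Y'}"
        then have "\<xi> * heat (d - 1) y t \<le> \<xi> * heat (d - 1) \<eta> t"
          using \<xi> heat_odd_mono[OF odd(1) t, of \<eta> y] by (simp add: mult_left_mono_neg)
        then show "(\<rho> * \<xi>, \<rho> * y, v, t) \<in> ?Q"
          using neg unfolding Q_iff by linarith
      qed
    qed (auto simp: Y'_def)
    moreover have "connected_component ?Q (\<rho> * \<xi>, \<rho> * Y', v, t) (\<rho> * X, \<rho> * Y', v, t)"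
    proof (rule connected_componentI)
      show "connected ((\<lambda>x. (\<rho> * x, \<rho> * Y', v, t)) ` {X..\<xi>})"
        by (intro connected_continuous_image continuous_intros connected_Icc)
      show "(\<lambda>x. (\<rho> * x, \<rho> * Y', v, t)) ` {X..\<xi>} \<subseteq> ?Q"
      proof (intro image_subsetI)
        fix x assume x: "x \<in> {X..\<xi>}"
        have "x * heat (d - 1) Y' t \<le> \<xi> * heat (d - 1) Y' t"
          using x \<xi> heat_odd_mono[OF odd(1) t, of \<eta> Y'] by (intro mult_right_mono) (auto simp: Y'_def)
        also have "\<dots> \<le> \<xi> * heat (d - 1) \<eta> t"
          using \<xi> heat_odd_mono[OF odd(1) t, of \<eta> Y'] by (simp add: mult_left_mono_neg Y'_def)
        finally show "(\<rho> * x, \<rho> * Y', v, t) \<in> ?Q"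
          using neg unfolding Q_iff by linarith
      qed
    qed (auto simp: X_def)
    moreover have "connected_component ?Q (\<rho> * X, \<rho> * Y', v, t) (\<rho> * X, \<rho> * Y', v, -1)"
    proof (rule connected_componentI)
      show "connected ((\<lambda>s. (\<rho> * X, \<rho> * Y', v, s)) ` {-1..t})"
        by (intro connected_continuous_image continuous_intros connected_Icc)
      show "(\<lambda>s. (\<rho> * X, \<rho> * Y', v, s)) ` {-1..t} \<subseteq> ?Q"
      proof (intro image_subsetI)
        fix s assume s: "s \<in> {-1..t}"
        have "1 \<le> heat (d - 1) Y' s"
          using Y[of Y' s] s t by (simp add: Y'_def abs_le_iff)
        moreover have "X \<le> 0"
          using \<xi> by (simp add: X_def)
        ultimately have "X * heat (d - 1) Y' s \<le> X * 1"
          by (intro mult_left_mono_neg)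
        moreover have "X \<le> - B - 1"
          by (simp add: X_def)
        ultimately show "(\<rho> * X, \<rho> * Y', v, s) \<in> ?Q"
          using B[OF s] unfolding Q_iff by linarith
      qed
    qed (use t in auto)
    ultimately have c: "connected_component ?Q (x, y, v, t) (\<rho> * X, \<rho> * Y', v, -1)"
      unfolding xy[symmetric] by (meson connected_component_trans)
    then show ?thesis
      using past[of "\<rho> * X" "\<rho> * Y'" v "-1"] connected_component_in[OF c] by (meson connected_component_trans neg_less_0_iff_less zero_less_one)
  qed
  have w_w: "connected_component ?Q (w t) (w (-1))" if "t < 0" for t
  proof (rule connected_componentI)
    show "connected (w ` {..<0})"
      unfolding w_def by (intro connected_continuous_image continuous_intros connected_Iio)
    show "w ` {..<0} \<subseteq> ?Q"
      using heat_w by (auto simp: w_def)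
  qed (use that in auto)
  have to_w: "connected_component ?Q a (w (-1))" if a: "a \<in> ?Q" for a
  proof -
    obtain x y v t where xy: "a = (x, y, v, t)"
      by (rule prod_cases4)
    show ?thesis
      using past[of x y v t] w_w[of t] future[of x y v t] a unfolding xy
      by (cases "t < 0") (auto intro: connected_component_trans)
  qed
  show ?thesis
    unfolding connected_iff_connected_component
    using to_w by (meson connected_component_sym connected_component_trans)
qed


section \<open>Nodal counts and the minimum\<close>

lemma two_set_nodal_domains:
  assumes "connected {z. p z > 0}" "connected {z. p z < 0}"
  shows "num_nodal_domains p \<le> 2"
proof -
  have "num_nodal_domains p \<le> enat 2"
  proof (rule num_nodal_domains_le)
    show "\<Union>{{z. p z > 0}, {z. p z < 0}} = {z. p z \<noteq> 0}"
      by auto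
    show "card {{z. p z > 0}, {z. p z < 0}} \<le> 2"
      by (simp add: card_insert_if)
  qed (use assms in auto)
  then show ?thesis
    by (simp add: numeral_eq_enat)
qed

lemma two_nodal_domains_example:
  fixes i j :: "'n::finite"
  assumes ij: "i \<noteq> j" and d: "d \<ge> 2" "\<not> 4 dvd d"
  shows "\<exists>p :: (real ^ 'n) \<times> real \<Rightarrow> real. hcp d p \<and> time_dependent p \<and> num_nodal_domains p \<le> 2"
proof (cases "even d")
  case True
  obtain \<epsilon> where \<epsilon>: "\<epsilon> > 0"
    "connected {(x, y, t). heat d x t + \<epsilon> * (x * heat (d - 1) y t) > 0}"
    "connected {(x, y, t). heat d x t + \<epsilon> * (x * heat (d - 1) y t) < 0}"
    by (rule heat_even_sum_connected[OF True d(1)]) (use d(2) in blast)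
  let ?p = "heat_sum d i \<epsilon> 1 i (d - 1) j"
  have "num_nodal_domains ?p \<le> 2"
    using \<epsilon>(2,3)[THEN connected_two_coords, OF ij]
    by (intro two_set_nodal_domains) (simp_all add: heat_sum_def heat_coord_def)
  then show ?thesis
    using heat_sum_hcp[of i j 1 "d - 1" d \<epsilon> i] ij d \<epsilon>(1) by (intro exI[of _ ?p]) auto
next
  case False
  obtain \<epsilon> where \<epsilon>: "\<epsilon> > 0" "connected {(x, y, t). heat d x t + \<epsilon> * heat d y t > 0}"
    "connected {(x, y, t). heat d x t + \<epsilon> * heat d y t < 0}"
    by (rule heat_odd_sum_connected[OF False]) blast
  let ?p = "heat_sum d i \<epsilon> 0 i d j"
  have "num_nodal_domains ?p \<le> 2"
    using \<epsilon>(2,3)[THEN connected_two_coords, OF ij]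
    by (intro two_set_nodal_domains) (simp_all add: heat_sum_def heat_coord_def)
  then show ?thesis
    using heat_sum_hcp[of i j 0 d d \<epsilon> i] ij d \<epsilon>(1) by (intro exI[of _ ?p]) auto
qed

lemma three_nodal_domains_example:
  fixes i j :: "'n::finite"
  assumes ij: "i \<noteq> j" and d: "d \<ge> 2" "even d"
  shows "\<exists>p :: (real ^ 'n) \<times> real \<Rightarrow> real. hcp d p \<and> time_dependent p \<and> num_nodal_domains p \<le> 3"
proof -
  obtain \<epsilon> where \<epsilon>: "\<epsilon> > 0"
    "connected {(x, y, t). heat d x t + \<epsilon> * (x * heat (d - 1) y t) > 0}"
    "connected {(x, y, t). x \<ge> 0 \<and> heat d x t + \<epsilon> * (x * heat (d - 1) y t) < 0}"
    "connected {(x, y, t). x \<le> 0 \<and> heat d x t + \<epsilon> * (x * heat (d - 1) y t) < 0}"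
    by (rule heat_even_sum_connected[OF d(2,1)]) blast
  let ?p = "heat_sum d i \<epsilon> 1 i (d - 1) j"
  have "num_nodal_domains ?p \<le> enat 3"
  proof (rule num_nodal_domains_le)
    show "\<Union>{{z. ?p z > 0}, {z. fst z $ i \<ge> 0 \<and> ?p z < 0}, {z. fst z $ i \<le> 0 \<and> ?p z < 0}} = {z. ?p z \<noteq> 0}"
      by auto
    show "card {{z. ?p z > 0}, {z. fst z $ i \<ge> 0 \<and> ?p z < 0}, {z. fst z $ i \<le> 0 \<and> ?p z < 0}} \<le> 3"
      by (simp add: card_insert_if)
    show "connected A" if "A \<in> {{z. ?p z > 0}, {z. fst z $ i \<ge> 0 \<and> ?p z < 0}, {z. fst z $ i \<le> 0 \<and> ?p z < 0}}" for A
      using that \<epsilon>(2-4)[THEN connected_two_coords, OF ij] by (auto simp: heat_sum_def heat_coord_def)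
  qed simp
  then show ?thesis
    using heat_sum_hcp[of i j 1 "d - 1" d \<epsilon> i] ij d \<epsilon>(1) by (intro exI[of _ ?p]) (auto simp: numeral_eq_enat)
qed

lemma two_nodal_domains_example_dim3:
  fixes i j k :: "'n::finite"
  assumes ij: "i \<noteq> j" "i \<noteq> k" "j \<noteq> k" and d: "d \<ge> 2" "even d"
  shows "\<exists>p :: (real ^ 'n) \<times> real \<Rightarrow> real. hcp d p \<and> time_dependent p \<and> num_nodal_domains p \<le> 2"
proof -
  \<comment> \<open>With coefficient 0 the sum is \<open>heat d\<close> in one coordinate, so the
    sign change of caloric polynomials yields a negative value. It occurs at a negative time, and
    homogeneity moves it to time -1.\<close>
  have "hcp d (heat_sum d k 0 0 i d j)"
    using heat_sum_hcp(1)[OF ij(1), of 0 d d 0 k] by simp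
  then obtain z where "heat_sum d k 0 0 i d j z < 0"
    using d by (elim hcp_sign_change) auto
  then obtain v t where v: "heat d v t < 0"
    by (auto simp: heat_sum_def heat_coord_def)
  then have t: "t < 0"
    using heat_even_nonneg[OF d(2), of t v] by linarith
  have "heat d (sqrt (- t) * (v / sqrt (- t))) ((sqrt (- t))\<^sup>2 * (-1)) = sqrt (- t) ^ d * heat d (v / sqrt (- t)) (-1)"
    by (rule heat_homogeneous)
  then have "sqrt (- t) ^ d * heat d (v / sqrt (- t)) (-1) < 0"
    using v t by simp
  then have v0: "heat d (v / sqrt (- t)) (-1) < 0"
    using t by (simp add: mult_less_0_iff)
  let ?p = "heat_sum d k 1 1 i (d - 1) j"
  have "num_nodal_domains ?p \<le> 2"
    using linear_heat_positive_connected[OF d(1), THEN connected_three_coords, OF ij]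
      linear_heat_negative_connected[OF d v0, THEN connected_three_coords, OF ij]
    by (intro two_set_nodal_domains) (simp_all add: heat_sum_def heat_coord_def add.commute)
  then show ?thesis
    using heat_sum_hcp[of i j 1 "d - 1" d 1 k] ij d by (intro exI[of _ ?p]) auto
qed

lemma hcp_two_nodal_domains:
  fixes p :: "(real ^ 'n::finite) \<times> real \<Rightarrow> real"
  assumes "hcp d p" "d > 0"
  shows "2 \<le> num_nodal_domains p"
  using hcp_sign_change[OF assms] sign_change_nodal_domains(1)[OF hcp_continuous_on[OF assms(1)]] by metis

text \<open>With fewer than three nodal domains both the positive and the negative set would be
  connected; passing to \<open>- p\<close> if necessary arranges
  \<open>p (0, 1) \<ge> 0\<close>.\<close>

lemma hcp_three_nodal_domains:
  fixes p :: "(real ^ 'n::finite) \<times> real \<Rightarrow> real"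
  assumes n: "CARD('n) = 2" and p: "hcp d p" and d: "d > 0" "4 dvd d"
  shows "3 \<le> num_nodal_domains p"
proof (rule ccontr)
  assume *: "\<not> ?thesis"
  obtain a b where ab: "p a > 0" "p b < 0"
    using hcp_sign_change[OF p d(1)] by blast
  have pos: "connected {z. p z > 0}"
    using sign_change_nodal_domains(2)[OF hcp_continuous_on[OF p] ab *] .
  have "connected {z. - p z > 0}"
    using sign_change_nodal_domains(2)[OF hcp_continuous_on[OF hcp_uminus[OF p]], of b a] ab *
    by (simp add: num_nodal_domains_uminus)
  then have neg: "connected {z. p z < 0}"
    by simp
  show False
    using hcp_4_dvd_not_connected[OF n p d _ pos neg]
      hcp_4_dvd_not_connected[OF n hcp_uminus[OF p] d] pos neg
    by (cases "p (0, 1) \<ge> 0") auto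
qed

lemma min_nodal_domains_eqI:
  assumes "\<And>p :: (real ^ 'n::finite) \<times> real \<Rightarrow> real. hcp d p \<Longrightarrow> k \<le> num_nodal_domains p"
    and "\<exists>p :: (real ^ 'n) \<times> real \<Rightarrow> real. hcp d p \<and> time_dependent p \<and> num_nodal_domains p \<le> k"
  shows "min_nodal_domains TYPE('n) d = k"
  unfolding min_nodal_domains_def
  using assms by (intro antisym INF_greatest) (auto intro: INF_lower2)

theorem theorem1p1:
  "(CARD('n::finite) = 2 \<longrightarrow>
      (\<forall>d\<ge>2. min_nodal_domains TYPE('n) d = (if d mod 4 \<noteq> 0 then 2 else 3))) \<and>
   (CARD('n) \<ge> 3 \<longrightarrow>
      (\<forall>d\<ge>2. min_nodal_domains TYPE('n) d = 2))"
proof (intro conjI impI allI)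
  fix d :: nat
  assume n: "CARD('n) = 2" and d: "2 \<le> d"
  obtain i j :: 'n where ij: "i \<noteq> j"
    using n by (auto simp: card_2_iff)
  show "min_nodal_domains TYPE('n) d = (if d mod 4 \<noteq> 0 then 2 else 3)"
  proof (cases "4 dvd d")
    case True
    have "min_nodal_domains TYPE('n) d = 3"
    proof (rule min_nodal_domains_eqI)
      show "3 \<le> num_nodal_domains p" if "hcp d p" for p :: "(real ^ 'n) \<times> real \<Rightarrow> real"
        using hcp_three_nodal_domains[OF n that _ True] d by simp
      have "even d"
        using True by presburger
      then show "\<exists>p :: (real ^ 'n) \<times> real \<Rightarrow> real. hcp d p \<and> time_dependent p \<and> num_nodal_domains p \<le> 3"
        by (rule three_nodal_domains_example[OF ij d])
    qed
    then show ?thesis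
      using True by (simp add: dvd_eq_mod_eq_0)
  next
    case False
    have "min_nodal_domains TYPE('n) d = 2"
    proof (rule min_nodal_domains_eqI)
      show "2 \<le> num_nodal_domains p" if "hcp d p" for p :: "(real ^ 'n) \<times> real \<Rightarrow> real"
        using hcp_two_nodal_domains[OF that] d by simp
    qed (rule two_nodal_domains_example[OF ij d False])
    then show ?thesis
      using False by (simp add: dvd_eq_mod_eq_0)
  qed
next
  fix d :: nat
  assume n: "CARD('n) \<ge> 3" and d: "2 \<le> d"
  obtain T :: "'n set" where "card T = 3"
    using n obtain_subset_with_card_n by metis
  then obtain i j k :: 'n where ij: "i \<noteq> j" "i \<noteq> k" "j \<noteq> k"
    by (auto simp: card_3_iff)
  show "min_nodal_domains TYPE('n) d = 2"
  proof (rule min_nodal_domains_eqI)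
    show "\<exists>p :: (real ^ 'n) \<times> real \<Rightarrow> real. hcp d p \<and> time_dependent p \<and> num_nodal_domains p \<le> 2"
    proof (cases "even d")
      case False
      then have "\<not> 4 dvd d"
        by presburger
      then show ?thesis
        by (rule two_nodal_domains_example[OF ij(1) d])
    qed (rule two_nodal_domains_example_dim3[OF ij d])
    show "2 \<le> num_nodal_domains p" if "hcp d p" for p :: "(real ^ 'n) \<times> real \<Rightarrow> real"
      using hcp_two_nodal_domains[OF that] d by simp
  qed
qed

end
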